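(* For every $\varepsilon>0$ there is a randomized algorithm for correlated stochastic knapsack with no cancellation, with running time polynomial in the input size and $\frac1\varepsilon$, whose expected reward is at least $(\frac12-\varepsilon)\,\mathrm{OPT}_{\mathrm{LP}'}$, and hence at least $\frac12-\varepsilon$ times the maximum expected reward of any policy.
   Context: Correlated stochastic knapsack with no cancellation: $n$ jobs $i\in[n]$, time budget $B$ (given in unary; time steps $1,\dots,B$). Job $i$ has random positive-integer processing time $S_i$ and random nonnegative reward $R_i$, with known joint distribution (possibly correlated); jobs independent. When no job is in progress the controller may start one not-yet-started job or idle; a started job cannot be cancelled and runs for $S_i$ steps, its realizations being revealed only as it runs; a job started at time $t$ yields its reward iff $t+S_i-1\le B$. Goal: maximize expected reward. $\mathrm{ER}_{i,t}=\sum_{t'=t+1}^{B+1}\mathbb{E}[R_i\mid S_i=t'-t]\Pr[S_i=t'-t]$. $(\mathrm{LP}')$: maximize $\sum_i\sum_{t=1}^B\mathrm{ER}_{i,t}x_{i,t}$ subject to $\sum_{i=1}^n\sum_{t'=1}^t x_{i,t'}\Pr[S_i>t-t']\le 1$ ($t\in[B]$), $0\le x_{i,t}\le s_{i,t}$, $s_{i,1}=1$, $s_{i,t}=s_{i,t-1}-x_{i,t-1}$ ($t>1$); $\mathrm{OPT}_{\mathrm{LP}'}$ is its optimum value. *)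

theory Defs
  imports "HOL-Probability.Probability" "HOL-Library.Log_Nat"
begin

section \<open>Problem instances\<close>

text \<open>
  The joint distribution of a job is part of the input of an algorithm, so it is given
  explicitly: a list of atoms (processing time, reward, probability) with rational entries.
  Atoms may repeat; their probabilities then add up.  Jobs are numbered from 0.
\<close>

record inst =
  budget :: nat
  jobs :: "(nat \<times> rat \<times> rat) list list"

abbreviation num_jobs :: "inst \<Rightarrow> nat" where
  "num_jobs I \<equiv> length (jobs I)"

definition weighted_outcomes :: "inst \<Rightarrow> nat \<Rightarrow> ((nat \<times> rat) \<times> real) list" where
  "weighted_outcomes I i = map (\<lambda>(s, r, p). ((s, r), of_rat p)) (jobs I ! i)"

definition job_pmf :: "inst \<Rightarrow> nat \<Rightarrow> (nat \<times> rat) pmf" where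
  "job_pmf I i = pmf_of_list (weighted_outcomes I i)"

definition valid_inst :: "inst \<Rightarrow> bool" where
  "valid_inst I \<longleftrightarrow> (\<forall>i < num_jobs I.
     pmf_of_list_wf (weighted_outcomes I i) \<and> (\<forall>(s, r, p) \<in> set (jobs I ! i). 1 \<le> s \<and> 0 \<le> r))"


section \<open>The linear program\<close>

definition size_prob :: "inst \<Rightarrow> nat \<Rightarrow> nat \<Rightarrow> real" where
  "size_prob I i k = measure_pmf.prob (job_pmf I i) {z. fst z = k}"

definition size_tail :: "inst \<Rightarrow> nat \<Rightarrow> nat \<Rightarrow> real" where
  "size_tail I i k = measure_pmf.prob (job_pmf I i) {z. fst z > k}"

text \<open>
  \<open>cond_reward I i k\<close> is the expected reward given that the processing time is \<open>k\<close>; it is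
  unspecified for \<open>k\<close> of probability 0, where it only occurs multiplied by \<open>size_prob I i k = 0\<close>.
\<close>

definition cond_reward :: "inst \<Rightarrow> nat \<Rightarrow> nat \<Rightarrow> real" where
  "cond_reward I i k =
     measure_pmf.expectation (cond_pmf (job_pmf I i) {z. fst z = k}) (\<lambda>z. of_rat (snd z))"

definition ER :: "inst \<Rightarrow> nat \<Rightarrow> nat \<Rightarrow> real" where
  "ER I i t = (\<Sum>t' = t + 1..budget I + 1. cond_reward I i (t' - t) * size_prob I i (t' - t))"

definition lp_feasible :: "inst \<Rightarrow> (nat \<Rightarrow> nat \<Rightarrow> real) \<Rightarrow> (nat \<Rightarrow> nat \<Rightarrow> real) \<Rightarrow> bool" where
  "lp_feasible I x s \<longleftrightarrow>
     (\<forall>t \<in> {1..budget I}. (\<Sum>i < num_jobs I. \<Sum>t' = 1..t. x i t' * size_tail I i (t - t')) \<le> 1) \<and>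
     (\<forall>i < num_jobs I. \<forall>t \<in> {1..budget I}. 0 \<le> x i t \<and> x i t \<le> s i t) \<and>
     (\<forall>i < num_jobs I. s i 1 = 1) \<and>
     (\<forall>i < num_jobs I. \<forall>t \<in> {2..budget I}. s i t = s i (t - 1) - x i (t - 1))"

definition lp_objective :: "inst \<Rightarrow> (nat \<Rightarrow> nat \<Rightarrow> real) \<Rightarrow> real" where
  "lp_objective I x = (\<Sum>i < num_jobs I. \<Sum>t = 1..budget I. ER I i t * x i t)"

definition OPT_LP :: "inst \<Rightarrow> real" where
  "OPT_LP I = Sup {lp_objective I x | x s. lp_feasible I x s}"


section \<open>Scheduling process\<close>

datatype action = Idle | Start nat

text \<open>
  A state consists of the next free time step, the set of jobs started so far, and the reward
  collected.  It describes the epochs at which no job is in progress; these are the only ones at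
  which there is a decision to make.
\<close>

type_synonym env = "nat \<times> nat set \<times> real"

definition env_reward :: "env \<Rightarrow> real" where
  "env_reward e = snd (snd e)"

definition init_env :: env where
  "init_env = (1, {}, 0)"

text \<open>
  The processing time and reward of a job are drawn when the job is started, independently of
  everything before; the controller learns them (\<open>Some\<close>) when the job completes within the budget.
  Attempts to start a nonexistent job, or one that was started before, count as idling.
  Nothing happens once the budget is exhausted.
\<close>

definition env_step :: "inst \<Rightarrow> action \<Rightarrow> env \<Rightarrow> ((nat \<times> rat) option \<times> env) pmf" where
  "env_step I a e = (case e of (t, A, w) \<Rightarrow>
     if t > budget I then return_pmf (None, (t, A, w))
     else (case a of
         Idle \<Rightarrow> return_pmf (None, (t + 1, A, w))
       | Start i \<Rightarrow>
           if i < num_jobs I \<and> i \<notin> A then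
             map_pmf (\<lambda>(s, r).
               if t + s - 1 \<le> budget I then (Some (s, r), (t + s, insert i A, w + of_rat r))
               else (None, (t + s, insert i A, w))) (job_pmf I i)
           else return_pmf (None, (t + 1, A, w))))"


section \<open>Policies\<close>

text \<open>
  Policies are adaptive and may randomize; they are not subject to any computational restriction.
\<close>

type_synonym history = "(action \<times> (nat \<times> rat) option) list"

type_synonym policy = "history \<Rightarrow> action pmf"

primrec play :: "inst \<Rightarrow> policy \<Rightarrow> nat \<Rightarrow> (history \<times> env) pmf" where
  "play I \<pi> 0 = return_pmf ([], init_env)"
| "play I \<pi> (Suc k) = do {
     (h, e) \<leftarrow> play I \<pi> k;
     a \<leftarrow> \<pi> h;
     (ob, e') \<leftarrow> env_step I a e;
     return_pmf (h @ [(a, ob)], e')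
   }"

text \<open>Every decision takes up at least one time step, so \<open>budget I\<close> decisions exhaust the budget.\<close>

definition policy_reward :: "inst \<Rightarrow> policy \<Rightarrow> real" where
  "policy_reward I \<pi> = measure_pmf.expectation (play I \<pi> (budget I)) (\<lambda>(h, e). env_reward e)"

definition OPT_policy :: "inst \<Rightarrow> real" where
  "OPT_policy I = (SUP \<pi>. policy_reward I \<pi>)"


section \<open>Randomized algorithms\<close>

text \<open>
  The model of computation is a random access machine on natural numbers with fair coin flips and
  logarithmic cost (every value that is computed, read or written, and every address, is charged
  its bit length), programmed in a structured language.  In addition the program acts as the
  controller of the scheduling process: \<open>Launch e a\<close> starts the job with number \<open>e\<close> and stores what
  is revealed (processing time, numerator and denominator of the reward) from address \<open>a\<close> on;
  the three cells are set to 0 if nothing is revealed.  \<open>Wait\<close> idles for one step of the process.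
  A program that halts before the budget is exhausted starts no further jobs.
\<close>

datatype expr =
    Lit nat
  | Mem expr
  | Add expr expr
  | Sub expr expr
  | Mul expr expr
  | Div expr expr

datatype com =
    Assign expr expr
  | Seq com com
  | Cond expr com com
  | Loop expr com
  | Flip expr
  | Launch expr expr
  | Wait

type_synonym mem = "nat \<Rightarrow> nat"

abbreviation bits :: "nat \<Rightarrow> nat" where
  "bits v \<equiv> floorlog 2 v"

primrec val :: "mem \<Rightarrow> expr \<Rightarrow> nat" where
  "val m (Lit v) = v"
| "val m (Mem e) = m (val m e)"
| "val m (Add e1 e2) = val m e1 + val m e2"
| "val m (Sub e1 e2) = val m e1 - val m e2"
| "val m (Mul e1 e2) = val m e1 * val m e2"
| "val m (Div e1 e2) = val m e1 div val m e2"

primrec cost :: "mem \<Rightarrow> expr \<Rightarrow> nat" where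
  "cost m (Lit v) = 1 + bits v"
| "cost m (Mem e) = 1 + bits (val m (Mem e)) + cost m e"
| "cost m (Add e1 e2) = 1 + bits (val m (Add e1 e2)) + cost m e1 + cost m e2"
| "cost m (Sub e1 e2) = 1 + bits (val m (Sub e1 e2)) + cost m e1 + cost m e2"
| "cost m (Mul e1 e2) = 1 + bits (val m (Mul e1 e2)) + cost m e1 + cost m e2"
| "cost m (Div e1 e2) = 1 + bits (val m (Div e1 e2)) + cost m e1 + cost m e2"

definition rat_code :: "rat \<Rightarrow> nat list" where
  "rat_code q = (case quotient_of q of (a, b) \<Rightarrow> [nat a, nat b])"

definition observation_code :: "(nat \<times> rat) option \<Rightarrow> nat list" where
  "observation_code ob = (case ob of None \<Rightarrow> [0, 0, 0] | Some (s, r) \<Rightarrow> s # rat_code r)"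

definition store :: "nat \<Rightarrow> nat list \<Rightarrow> mem \<Rightarrow> mem" where
  "store a vs m = (\<lambda>k. if a \<le> k \<and> k < a + length vs then vs ! (k - a) else m k)"

text \<open>
  A configuration consists of the commands still to be executed, the memory, the state of the
  scheduling process, and the computing time spent so far (which is unrelated to the time of the
  scheduling process).
\<close>

type_synonym config = "com list \<times> mem \<times> env \<times> nat"

fun step :: "inst \<Rightarrow> config \<Rightarrow> config pmf" where
  "step I ([], m, e, T) = return_pmf ([], m, e, T)"
| "step I (Assign a b # cs, m, e, T) =
     return_pmf (cs, m(val m a := val m b), e, T + 1 + cost m a + cost m b)"
| "step I (Seq c1 c2 # cs, m, e, T) = return_pmf (c1 # c2 # cs, m, e, T + 1)"
| "step I (Cond b c1 c2 # cs, m, e, T) =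
     return_pmf ((if val m b \<noteq> 0 then c1 else c2) # cs, m, e, T + 1 + cost m b)"
| "step I (Loop b c # cs, m, e, T) =
     return_pmf (if val m b \<noteq> 0 then c # Loop b c # cs else cs, m, e, T + 1 + cost m b)"
| "step I (Flip a # cs, m, e, T) =
     map_pmf (\<lambda>v. (cs, m(val m a := of_bool v), e, T + 1 + cost m a)) (bernoulli_pmf (1 / 2))"
| "step I (Launch b a # cs, m, e, T) =
     map_pmf (\<lambda>(ob, e').
       (cs, store (val m a) (observation_code ob) m, e',
        T + 1 + cost m b + cost m a + sum_list (map bits (observation_code ob))))
     (env_step I (Start (val m b)) e)"
| "step I (Wait # cs, m, e, T) =
     map_pmf (\<lambda>(ob, e'). (cs, m, e', T + 1)) (env_step I Idle e)"

definition job_code :: "(nat \<times> rat \<times> rat) list \<Rightarrow> nat list" where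
  "job_code xs = length xs # concat (map (\<lambda>(s, r, p). s # rat_code r @ rat_code p) xs)"

definition inst_code :: "inst \<Rightarrow> nat list" where
  "inst_code I = budget I # num_jobs I # concat (map job_code (jobs I))"

text \<open>The summand \<open>budget I\<close> accounts for the unary encoding of the time budget.\<close>

definition input_size :: "inst \<Rightarrow> nat" where
  "input_size I = budget I + (\<Sum>v \<leftarrow> inst_code I. 1 + bits v)"

definition init_config :: "inst \<Rightarrow> com \<Rightarrow> config" where
  "init_config I P = ([P], store 0 (inst_code I) (\<lambda>_. 0), init_env, 0)"

primrec run :: "inst \<Rightarrow> com \<Rightarrow> nat \<Rightarrow> config pmf" where
  "run I P 0 = return_pmf (init_config I P)"
| "run I P (Suc k) = run I P k \<bind> step I"

text \<open>The bound on the running time is worst case, over both coin flips and job realizations.\<close>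

definition runs_in_time :: "inst \<Rightarrow> com \<Rightarrow> real \<Rightarrow> bool" where
  "runs_in_time I P b \<longleftrightarrow>
     (\<exists>k. \<forall>(cs, m, e, T) \<in> set_pmf (run I P k). cs = [] \<and> real T \<le> b)"

text \<open>For a program that halts within \<open>k\<close> steps the sequence is constant from \<open>k\<close> on.\<close>

definition alg_reward :: "inst \<Rightarrow> com \<Rightarrow> real" where
  "alg_reward I P =
     lim (\<lambda>k. measure_pmf.expectation (run I P k) (\<lambda>(cs, m, e, T). env_reward e))"


section \<open>The two optimum values are suprema of nonempty bounded sets\<close>

lemma lp_nonempty: "lp_feasible I (\<lambda>_ _. 0) (\<lambda>_ _. 1)"
  by (simp add: lp_feasible_def)

lemma lp_bdd: "bdd_above {lp_objective I x | x s. lp_feasible I x s}"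
proof -
  have "lp_objective I x \<le> (\<Sum>i < num_jobs I. \<Sum>t = 1..budget I. \<bar>ER I i t\<bar>)" if f: "lp_feasible I x s" for x s
  proof -
    have s1: "s i t \<le> 1" if i: "i < num_jobs I" and "1 \<le> t" "t \<le> budget I" for i t
      using that(2,3)
    proof (induction t rule: dec_induct)
      case base then show ?case using f i by (simp add: lp_feasible_def)
    next
      case (step t)
      then have "s i (Suc t) = s i t - x i t" "0 \<le> x i t"
        using f i by (auto simp: lp_feasible_def dest!: bspec[where x="Suc t"])
      then show ?case using step by simp
    qed
    have "ER I i t * x i t \<le> \<bar>ER I i t\<bar>" if "i < num_jobs I" "1 \<le> t" "t \<le> budget I" for i t
    proof -
      have "0 \<le> x i t \<and> x i t \<le> s i t" using f that by (simp add: lp_feasible_def)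
      then have "0 \<le> x i t" "x i t \<le> 1" using s1[OF that] by linarith+
      then have "\<bar>ER I i t * x i t\<bar> \<le> \<bar>ER I i t\<bar>" by (simp add: abs_mult mult_left_le)
      then show ?thesis by linarith
    qed
    then show ?thesis unfolding lp_objective_def by (intro sum_mono) auto
  qed
  then show ?thesis by (auto intro!: bdd_aboveI)
qed

lemma reward_bound: assumes "valid_inst I"
  shows "\<exists>C::real. C \<ge> 0 \<and> (\<forall>i<num_jobs I. \<forall>z\<in>set_pmf (job_pmf I i). 0 \<le> (of_rat (snd z)::real) \<and> of_rat (snd z) \<le> C)"
proof -
  define R where "R = (\<Union>i<num_jobs I. (\<lambda>(s,r,p). of_rat r :: real) ` set (jobs I ! i))"
  have "finite R" by (simp add: R_def)
  have sub: "\<exists>p. (fst z, snd z, p) \<in> set (jobs I ! i)" if "i < num_jobs I" "z \<in> set_pmf (job_pmf I i)" for i z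
  proof -
    have wf: "pmf_of_list_wf (weighted_outcomes I i)" using assms that by (auto simp: valid_inst_def)
    have "z \<in> set (map fst (weighted_outcomes I i))" using set_pmf_of_list[OF wf] that by (auto simp: job_pmf_def)
    then obtain y where "y \<in> set (jobs I ! i)" "z = fst (case y of (s, r, p) \<Rightarrow> ((s, r), of_rat p :: real))"
      unfolding weighted_outcomes_def by auto
    then show ?thesis by (cases y rule: prod_cases3) auto
  qed
  show ?thesis
  proof (intro exI[of _ "Max (insert 0 R)"] conjI allI impI ballI)
    show "0 \<le> Max (insert 0 R)" using \<open>finite R\<close> by simp
    fix i z assume iz: "i < num_jobs I" "z \<in> set_pmf (job_pmf I i)"
    obtain p where p: "(fst z, snd z, p) \<in> set (jobs I ! i)" using sub[OF iz] by blast
    have "\<forall>(s, r, p) \<in> set (jobs I ! i). 1 \<le> s \<and> 0 \<le> r"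
      using assms iz by (simp add: valid_inst_def)
    then have "0 \<le> snd z" using p by (auto dest: bspec)
    then show "0 \<le> (of_rat (snd z)::real)" by simp
    have "of_rat (snd z) \<in> R"
      unfolding R_def using p iz(1) by (intro UN_I[of i] image_eqI[of _ _ "(fst z, snd z, p)"]) auto
    then show "of_rat (snd z) \<le> Max (insert 0 R)" using \<open>finite R\<close> by simp
  qed
qed

lemma policy_bdd: assumes "valid_inst I" shows "bdd_above (range (policy_reward I))"
proof -
  obtain C :: real where C: "C \<ge> 0" "\<And>i z. i<num_jobs I \<Longrightarrow> z\<in>set_pmf (job_pmf I i) \<Longrightarrow> 0 \<le> (of_rat (snd z)::real) \<and> of_rat (snd z) \<le> C"
    using reward_bound[OF assms] by blast
  have st: "env_reward e \<le> env_reward (snd y) \<and> env_reward (snd y) \<le> env_reward e + C" if y: "y \<in> set_pmf (env_step I a e)" for y a e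
  proof -
    obtain t A w where e: "e = (t, A, w)" by (cases e)
    show ?thesis
    proof (cases "\<exists>i. a = Start i \<and> i < num_jobs I \<and> i \<notin> A \<and> t \<le> budget I")
      case True
      then obtain i where i: "a = Start i" "i < num_jobs I" "i \<notin> A" "t \<le> budget I" by blast
      then obtain z where z: "z \<in> set_pmf (job_pmf I i)"
        and y': "y = (case z of (s, r) \<Rightarrow>
               if t + s - 1 \<le> budget I then (Some (s, r), (t + s, insert i A, w + of_rat r))
               else (None, (t + s, insert i A, w)))"
        using y by (auto simp: e env_step_def)
      show ?thesis using C(1) C(2)[OF i(2) z] y' by (cases z) (use C(1) in \<open>simp add: e env_reward_def\<close>)
    next
      case False
      then show ?thesis using that C(1)
        by (cases a) (auto simp: e env_step_def env_reward_def split: if_splits)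
    qed
  qed
  have pl: "0 \<le> env_reward (snd y) \<and> env_reward (snd y) \<le> real k * C" if "y \<in> set_pmf (play I \<pi> k)" for y k \<pi>
    using that
  proof (induction k arbitrary: y)
    case 0 then show ?case by (simp add: init_env_def env_reward_def)
  next
    case (Suc k)
    then obtain x a z where x: "x \<in> set_pmf (play I \<pi> k)" and z: "z \<in> set_pmf (env_step I a (snd x))"
      and "snd y = snd z"
      by (auto simp: split_beta)
    then show ?case using Suc.IH[OF x] st[OF z] by (simp add: algebra_simps)
  qed
  have "policy_reward I \<pi> \<le> real (budget I) * C" for \<pi>
    unfolding policy_reward_def
  proof (rule measure_pmf.integral_le_const)
    show "integrable (measure_pmf (play I \<pi> (budget I))) (\<lambda>(h, e). env_reward e)"
      using pl[of _ \<pi> "budget I"]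
      by (intro measure_pmf.integrable_const_bound[where B="real (budget I) * C"])
        (simp_all add: AE_measure_pmf_iff split_beta)
    show "AE x in measure_pmf (play I \<pi> (budget I)). (case x of (h, e) \<Rightarrow> env_reward e) \<le> real (budget I) * C"
      using pl[of _ \<pi> "budget I"] by (simp add: AE_measure_pmf_iff split_beta)
  qed
  then show ?thesis by (auto intro!: bdd_aboveI)
qed

end

theory Submission imports Defs begin

text \<open>
  No linear program has to be solved.  Backwards in time, give each time step \<open>t\<close> the price
  \<open>v t = max 0 (max_i gain_i t)\<close>, where \<open>gain_i t\<close> is the expected value of starting job \<open>i\<close> at time \<open>t\<close>
  (reward plus all prices from its completion on) minus the prices of all later steps and minus the prices
  already attributed to \<open>i\<close>; attribute \<open>v t\<close> to a maximizing job \<open>b t\<close>.  The time prices together with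
  the totals per job form a feasible dual solution of \<open>(LP')\<close> of value at most \<open>2 * (\<Sum>t. v t)\<close>, and the
  corresponding potential is a supermartingale under every policy.  Conversely the plan \<open>start b t if
  the machine is free at time t\<close> collects at least \<open>\<Sum>t. v t\<close> in expectation, because the
  reward collected so far plus the remaining prices attributed to jobs not yet started is a submartingale.  So this deterministic plan
  is an exact 1/2-approximation, independently of \<open>\<epsilon>\<close>.

  The prices are rationals whose denominators divide powers of a common denominator \<open>D\<close> of the input; the
  program computes them as integers, multiplying everything by \<open>D\<close> in every round.  Their bit lengths stay
  polynomial, since every price is bounded by the largest reward.
\<close>

section \<open>Expectations over a job\<close>

text \<open>Starting a job costs twice: it blocks the machine until completion, and it spoils every
  later step at which the plan meant to start the same job. A gain charges both: it is the expected
  reward minus the prices of the steps after \<open>t\<close> that the job occupies, minus the later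
  prices attributed to the job. Hence a single number serves two purposes:
  \<open>gain \<le> v\<close> for all jobs is dual feasibility, while equality at \<open>b t\<close>
  compensates the plan for what it gives up. The factor 2 reflects the double charge, since each
  price occurs once as the price of a step and once in the total of at most one job. The totals are
  the multipliers of the constraints that the values \<open>x i t\<close> of one job add up to at
  most 1, which is what the variables \<open>s\<close> of \<open>(LP')\<close> encode. In the
  program the numbers are naturals, so truncated subtraction supplies the \<open>max 0\<close>.
  Prices do not compound from round to round because a later completion never raises the remaining
  prices, so a start gains at most its own reward.\<close>

lemma expectation_pmf_of_list:
  fixes f :: "'a \<Rightarrow> real"
  assumes "pmf_of_list_wf xs"
  shows "measure_pmf.expectation (pmf_of_list xs) f = (\<Sum>(x, p)\<leftarrow>xs. p * f x)"
proof -
  have "measure_pmf.expectation (pmf_of_list xs) f = (\<Sum>a\<in>fst ` set xs. pmf (pmf_of_list xs) a * f a)"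
    using set_pmf_of_list[OF assms] by (subst integral_measure_pmf[of "fst ` set xs"]) auto
  also have "\<dots> = (\<Sum>a\<in>fst ` set xs. \<Sum>y\<leftarrow>xs. if fst y = a then snd y * f a else 0)"
    unfolding pmf_pmf_of_list[OF assms]
    by (intro sum.cong refl)
      (simp add: sum_list_map_filter' sum_list_mult_const[symmetric] if_distribR if_distrib[of "\<lambda>x. x * f _"] cong: if_cong)
  \<comment> \<open>Atoms may repeat, so the mass of a value is itself a sum over the list. After
    the exchange the inner sum collapses to the value of the one list entry.\<close>
  also have "\<dots> = (\<Sum>y\<leftarrow>xs. \<Sum>a\<in>fst ` set xs. if fst y = a then snd y * f a else 0)"
    by (simp add: sum_list_sum_nth sum.swap[of _ "{0..<length xs}"])
  also have "\<dots> = (\<Sum>y\<leftarrow>xs. snd y * f (fst y))"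
    by (intro arg_cong[of _ _ sum_list] map_cong refl) simp
  finally show ?thesis by (simp add: case_prod_unfold)
qed

section \<open>Expectations over one job of a valid instance, and the coefficients of the linear
  program\<close>

locale knapsack =
  fixes I :: inst
  assumes valid: "valid_inst I"
begin

abbreviation "B \<equiv> budget I"
abbreviation "n \<equiv> num_jobs I"

definition E :: "nat \<Rightarrow> (nat \<times> rat \<Rightarrow> real) \<Rightarrow> real" where
  "E i f = measure_pmf.expectation (job_pmf I i) f"

lemma wf: "i < n \<Longrightarrow> pmf_of_list_wf (weighted_outcomes I i)"
  using valid by (simp add: valid_inst_def)

lemma finite_job: "i < n \<Longrightarrow> finite (set_pmf (job_pmf I i))"
  unfolding job_pmf_def by (rule finite_set_pmf_of_list[OF wf])

lemma integrable_job: "i < n \<Longrightarrow> integrable (measure_pmf (job_pmf I i)) (f :: _ \<Rightarrow> real)"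
  by (rule integrable_measure_pmf_finite[OF finite_job])

lemma job_support:
  assumes "i < n" "(s, r) \<in> set_pmf (job_pmf I i)"
  shows "\<exists>p. (s, r, p) \<in> set (jobs I ! i)"
proof -
  have "(s, r) \<in> fst ` set (weighted_outcomes I i)"
    using set_pmf_of_list[OF wf[OF assms(1)]] assms(2) by (auto simp: job_pmf_def)
  then show ?thesis by (force simp: weighted_outcomes_def)
qed

lemma atom_valid:
  assumes "i < n" "(s, r, p) \<in> set (jobs I ! i)"
  shows "1 \<le> s" "0 \<le> r" "0 \<le> p"
proof -
  show "1 \<le> s" "0 \<le> r" using valid assms by (auto simp: valid_inst_def)
  have "(of_rat p :: real) \<in> set (map snd (weighted_outcomes I i))"
    using assms(2) by (force simp: weighted_outcomes_def)
  then have "0 \<le> (of_rat p :: real)" using wf[OF assms(1)] unfolding pmf_of_list_wf_def by blast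
  then show "0 \<le> p" by simp
qed

lemma job_support_valid:
  assumes "i < n" "(s, r) \<in> set_pmf (job_pmf I i)"
  shows "1 \<le> s" "0 \<le> r"
  using job_support[OF assms] atom_valid[OF assms(1)] by blast+

lemma E_atoms: "i < n \<Longrightarrow> E i f = (\<Sum>(s, r, p)\<leftarrow>jobs I ! i. of_rat p * f (s, r))"
  using expectation_pmf_of_list[OF wf, of i f]
  by (simp add: E_def job_pmf_def weighted_outcomes_def case_prod_unfold o_def)

lemma jobs_nonempty: "i < n \<Longrightarrow> jobs I ! i \<noteq> []"
  using wf[of i] by (auto simp: pmf_of_list_wf_def weighted_outcomes_def)

lemma E_mono:
  assumes "i < n" "\<And>s r. (s, r) \<in> set_pmf (job_pmf I i) \<Longrightarrow> f (s, r) \<le> g (s, r)"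
  shows "E i f \<le> E i g"
  unfolding E_def using assms(2)
  by (intro integral_mono_AE integrable_job assms(1)) (auto simp: AE_measure_pmf_iff)

lemma E_add: "i < n \<Longrightarrow> E i (\<lambda>z. f z + g z) = E i f + E i g"
  unfolding E_def by (intro Bochner_Integration.integral_add integrable_job)

lemma E_const [simp]: "E i (\<lambda>z. c) = c"
  unfolding E_def by simp

lemma E_cmult: "E i (\<lambda>z. c * f z) = c * E i f"
  unfolding E_def by simp

lemma E_sum: "i < n \<Longrightarrow> E i (\<lambda>z. \<Sum>k\<in>K. f k z) = (\<Sum>k\<in>K. E i (f k))"
  unfolding E_def by (intro Bochner_Integration.integral_sum integrable_job)

lemma E_tail: "E i (\<lambda>z. of_bool (fst z > k)) = size_tail I i k"
proof -
  have "(\<lambda>z::nat \<times> rat. of_bool (fst z > k) :: real) = indicator {z. fst z > k}"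
    by (auto simp: indicator_def)
  then show ?thesis by (simp add: E_def size_tail_def)
qed

text \<open>The second factor cancels the normalization of the conditional distribution. On a null
  event the conditional expectation is unspecified, but it is multiplied by 0.\<close>

lemma cond_reward_size_prob:
  assumes "i < n"
  shows "cond_reward I i k * size_prob I i k = E i (\<lambda>z. of_bool (fst z = k) * of_rat (snd z))"
proof (cases "set_pmf (job_pmf I i) \<inter> {z. fst z = k} = {}")
  case True
  then have "size_prob I i k = 0"
    by (simp add: size_prob_def measure_pmf_zero_iff)
  moreover have "E i (\<lambda>z. of_bool (fst z = k) * of_rat (snd z)) = E i (\<lambda>z. 0)"
    unfolding E_def using True by (intro integral_cong_AE) (auto simp: AE_measure_pmf_iff)
  ultimately show ?thesis by simp
next
  case False
  let ?p = "job_pmf I i" and ?S = "{z :: nat \<times> rat. fst z = k}"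
  have pos: "measure_pmf.prob ?p ?S \<noteq> 0"
    using False by (simp add: measure_pmf_zero_iff)
  have "cond_reward I i k = (\<Sum>z\<in>set_pmf ?p. pmf (cond_pmf ?p ?S) z * of_rat (snd z))"
    unfolding cond_reward_def using finite_job[OF assms] set_cond_pmf[OF False]
    by (subst integral_measure_pmf[of "set_pmf ?p"]) auto
  also have "\<dots> * size_prob I i k = (\<Sum>z\<in>set_pmf ?p. pmf ?p z * (of_bool (fst z = k) * of_rat (snd z)))"
    unfolding sum_distrib_right size_prob_def
    by (intro sum.cong refl) (use pos in \<open>auto simp: pmf_cond[OF False]\<close>)
  also have "\<dots> = E i (\<lambda>z. of_bool (fst z = k) * of_rat (snd z))"
    unfolding E_def using finite_job[OF assms] by (subst integral_measure_pmf[of "set_pmf ?p"]) auto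
  finally show ?thesis .
qed

lemma E_cong:
  assumes "i < n" "\<And>s r. (s, r) \<in> set_pmf (job_pmf I i) \<Longrightarrow> f (s, r) = g (s, r)"
  shows "E i f = E i g"
  by (intro antisym E_mono assms(1)) (simp_all add: assms(2))

text \<open>Processing times are positive, so for an outcome of size \<open>s\<close> only the
  summand \<open>t' = t + s\<close> survives, and it lies in the range iff the job completes by step
  \<open>B\<close>.\<close>

lemma ER_eq:
  assumes "i < n"
  shows "ER I i t = E i (\<lambda>(s, r). if t + s \<le> B + 1 then of_rat r else 0)"
proof -
  have "ER I i t = E i (\<lambda>z. \<Sum>t'=t+1..B+1. of_bool (fst z = t' - t) * of_rat (snd z))"
    unfolding ER_def cond_reward_size_prob[OF assms] E_sum[OF assms] ..
  also have "\<dots> = E i (\<lambda>(s, r). if t + s \<le> B + 1 then of_rat r else 0)"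
  proof (rule E_cong[OF assms])
    fix s r assume "(s, r) \<in> set_pmf (job_pmf I i)"
    then have "1 \<le> s" using job_support_valid assms by blast
    then have "(\<Sum>t'=t+1..B+1. of_bool (s = t' - t) * (of_rat r :: real))
      = (\<Sum>t'\<in>{t+1..B+1}. if t' = t + s then of_rat r else 0)"
      by (intro sum.cong refl) auto
    then show "(\<Sum>t'=t+1..B+1. of_bool (fst (s, r) = t' - t) * of_rat (snd (s, r))) =
         (case (s, r) of (s, r) \<Rightarrow> if t + s \<le> B + 1 then of_rat r else (0::real))"
      using \<open>1 \<le> s\<close> by simp
  qed
  finally show ?thesis .
qed

section \<open>Prices and their value bounds\<close>

text \<open>
  \<open>v t\<close> is the price of time step \<open>t\<close>, and \<open>b t\<close> the job to which it is attributed (a number that is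
  not a job if \<open>v t = 0\<close>).
\<close>

definition tail_price :: "(nat \<Rightarrow> real) \<Rightarrow> nat \<Rightarrow> real" where
  "tail_price v t = (\<Sum>\<tau>\<in>{t..B}. v \<tau>)"

definition job_price :: "(nat \<Rightarrow> real) \<Rightarrow> (nat \<Rightarrow> nat) \<Rightarrow> nat \<Rightarrow> nat \<Rightarrow> real" where
  "job_price v b i t = (\<Sum>\<tau>\<in>{t<..B}. of_bool (b \<tau> = i) * v \<tau>)"

text \<open>Here \<open>h\<close> values a machine that becomes free at a given step. It is
  instantiated both with the remaining prices and with what the plan can still collect.\<close>

definition payoff :: "(nat \<Rightarrow> real) \<Rightarrow> nat \<Rightarrow> nat \<times> rat \<Rightarrow> real" where
  "payoff h t z = (if t + fst z \<le> B + 1 then of_rat (snd z) else 0) + h (t + fst z)"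

definition gain :: "(nat \<Rightarrow> real) \<Rightarrow> (nat \<Rightarrow> nat) \<Rightarrow> nat \<Rightarrow> nat \<Rightarrow> real" where
  "gain v b i t = E i (payoff (tail_price v) t) - tail_price v (t + 1) - job_price v b i t"

text \<open>The bounds on the gains serve the upper bounds on the optima, the equation serves the
  plan. The parameter \<open>t0\<close> is there because the construction runs backwards and has
  fixed the prices only from some step on.\<close>

definition balanced :: "(nat \<Rightarrow> real) \<Rightarrow> (nat \<Rightarrow> nat) \<Rightarrow> nat \<Rightarrow> bool" where
  "balanced v b t0 \<longleftrightarrow> (\<forall>t\<in>{t0..B}. 0 \<le> v t \<and> (\<forall>i<n. gain v b i t \<le> v t) \<and>
     v t = (if b t < n then gain v b (b t) t else 0))"

definition plan_value :: "(nat \<Rightarrow> real) \<Rightarrow> (nat \<Rightarrow> nat) \<Rightarrow> nat \<Rightarrow> nat set \<Rightarrow> real" where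
  "plan_value v b t A = (\<Sum>\<tau>\<in>{t..B}. of_bool (b \<tau> \<notin> A) * v \<tau>)"

lemma balanced_nonneg: "balanced v b t0 \<Longrightarrow> \<tau> \<in> {t0..B} \<Longrightarrow> 0 \<le> v \<tau>"
  unfolding balanced_def by blast

lemma tail_price_beyond: "B < t \<Longrightarrow> tail_price v t = 0"
  by (simp add: tail_price_def)

lemma tail_price_rec: "t \<le> B \<Longrightarrow> tail_price v t = v t + tail_price v (Suc t)"
  by (simp add: tail_price_def sum.atLeast_Suc_atMost)

lemma plan_value_beyond: "B < t \<Longrightarrow> plan_value v b t A = 0"
  by (simp add: plan_value_def)

lemma plan_value_rec:
  "t \<le> B \<Longrightarrow> plan_value v b t A = of_bool (b t \<notin> A) * v t + plan_value v b (Suc t) A"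
  unfolding plan_value_def by (rule sum.atLeast_Suc_atMost)

text \<open>This is the submartingale step at a launch. The price \<open>v t\<close> equals the gain
  of \<open>b t\<close>, and this gain has already been reduced by everything the launch can
  destroy: prices of occupied steps and prices of later steps planned for the same job.\<close>

lemma plan_value_start:
  assumes bal: "balanced v b 1" and t: "1 \<le> t" "t \<le> B" and i: "b t < n" "b t \<notin> A"
  shows "plan_value v b t A \<le> E (b t) (payoff (\<lambda>t'. plan_value v b t' (insert (b t) A)) t)"
proof -
  let ?i = "b t"
  have nn: "0 \<le> v \<tau>" if "\<tau> \<in> {1..B}" for \<tau>
    using balanced_nonneg[OF bal] that by blast
  have vt: "v t = gain v b ?i t"
    using bal t i by (auto simp: balanced_def)
  have key: "payoff (tail_price v) t (s, r) + (plan_value v b (t+1) A - tail_price v (t+1) - job_price v b ?i t)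
     \<le> payoff (\<lambda>t'. plan_value v b t' (insert ?i A)) t (s, r)" if s: "1 \<le> s" for s r
  proof -
    have "plan_value v b (t+1) A + tail_price v (t+s)
      = (\<Sum>\<tau>\<in>{t<..B}. of_bool (b \<tau> \<notin> A) * v \<tau> + of_bool (t + s \<le> \<tau>) * v \<tau>)"
    proof -
      have "tail_price v (t+s) = (\<Sum>\<tau>\<in>{t<..B}. of_bool (t + s \<le> \<tau>) * v \<tau>)"
        unfolding tail_price_def using s by (intro sum.mono_neutral_cong_left) auto
      moreover have "plan_value v b (t+1) A = (\<Sum>\<tau>\<in>{t<..B}. of_bool (b \<tau> \<notin> A) * v \<tau>)"
        unfolding plan_value_def by (intro sum.cong) auto
      ultimately show ?thesis by (simp add: sum.distrib)
    qed
    \<comment> \<open>Two indicators add up to at most their conjunction plus 1. Excluding the steps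
      of \<open>b t\<close> from the conjunction costs at most the price attributed to that
      job.\<close>
    also have "\<dots> \<le> (\<Sum>\<tau>\<in>{t<..B}. of_bool (t + s \<le> \<tau> \<and> b \<tau> \<notin> insert ?i A) * v \<tau>
        + (v \<tau> + of_bool (b \<tau> = ?i) * v \<tau>))"
      using nn t by (intro sum_mono) auto
    also have "\<dots> = plan_value v b (t+s) (insert ?i A) + tail_price v (t+1) + job_price v b ?i t"
    proof -
      have "plan_value v b (t+s) (insert ?i A)
        = (\<Sum>\<tau>\<in>{t<..B}. of_bool (t + s \<le> \<tau> \<and> b \<tau> \<notin> insert ?i A) * v \<tau>)"
        unfolding plan_value_def using s by (intro sum.mono_neutral_cong_left) auto
      moreover have "tail_price v (t+1) = (\<Sum>\<tau>\<in>{t<..B}. v \<tau>)"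
        unfolding tail_price_def by (intro sum.cong) auto
      ultimately show ?thesis by (simp add: sum.distrib job_price_def)
    qed
    finally show ?thesis by (simp add: payoff_def)
  qed
  have "plan_value v b t A = v t + plan_value v b (t+1) A"
    using plan_value_rec[OF t(2), of v b A] i by simp
  also have "\<dots> = E ?i (\<lambda>z. payoff (tail_price v) t z + (plan_value v b (t+1) A - tail_price v (t+1) - job_price v b ?i t))"
    using i by (simp add: vt gain_def E_add)
  also have "\<dots> \<le> E ?i (payoff (\<lambda>t'. plan_value v b t' (insert ?i A)) t)"
    using key job_support_valid i by (intro E_mono) auto
  finally show ?thesis .
qed

text \<open>Each step is attributed to at most one job. This bounds the second half of the dual
  objective by the first and is the source of the factor 2.\<close>

lemma job_price_total:
  assumes bal: "balanced v b 1"
  shows "(\<Sum>i<n. job_price v b i 0) \<le> tail_price v 1"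
proof -
  have nn: "0 \<le> v \<tau>" if "\<tau> \<in> {1..B}" for \<tau>
    using balanced_nonneg[OF bal] that by blast
  have "(\<Sum>i<n. job_price v b i 0) = (\<Sum>\<tau>\<in>{0<..B}. (\<Sum>i<n. of_bool (b \<tau> = i)) * v \<tau>)"
    unfolding job_price_def by (subst sum.swap) (simp add: sum_distrib_right)
  also have "\<dots> \<le> (\<Sum>\<tau>\<in>{0<..B}. v \<tau>)"
    using nn by (intro sum_mono) (auto simp: of_bool_def sum.delta)
  also have "\<dots> = tail_price v 1"
    unfolding tail_price_def by (intro sum.cong) auto
  finally show ?thesis .
qed

lemma job_price_nonneg: "balanced v b 1 \<Longrightarrow> 0 \<le> job_price v b i t"
  unfolding job_price_def by (intro sum_nonneg) (auto simp: balanced_nonneg)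

lemma job_price_le: 
  assumes "balanced v b 1"
  shows "job_price v b i t \<le> job_price v b i 0"
  unfolding job_price_def using assms by (intro sum_mono2) (auto simp: balanced_nonneg)

text \<open>The bound \<open>gain v b i t \<le> v t\<close> rearranged, with the attribution after
  \<open>t\<close> enlarged to the total of the job. In this form the gains enter both upper bounds,
  for the linear program and for policies.\<close>

lemma E_payoff_le:
  assumes bal: "balanced v b 1" and "1 \<le> t" "t \<le> B" "i < n"
  shows "E i (payoff (tail_price v) t) \<le> tail_price v t + job_price v b i 0"
proof -
  have "\<forall>t\<in>{1..B}. \<forall>i<n. gain v b i t \<le> v t" using bal unfolding balanced_def by blast
  then have "gain v b i t \<le> v t" using assms by simp
  then show ?thesis
    using tail_price_rec[of t v] job_price_le[OF bal, of i t] assms by (simp add: gain_def)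
qed

subsection \<open>The linear program\<close>

text \<open>Dual feasibility for the variable \<open>x i t\<close>: the multipliers are
  \<open>v \<tau>\<close> for the machine constraint at \<open>\<tau>\<close> and the total of job
  \<open>i\<close> for the constraint that its variables sum to at most 1.\<close>

lemma ER_le:
  assumes bal: "balanced v b 1" and t: "1 \<le> t" "t \<le> B" and i: "i < n"
  shows "ER I i t \<le> (\<Sum>\<tau>\<in>{t..B}. v \<tau> * size_tail I i (\<tau> - t)) + job_price v b i 0"
proof -
  have "ER I i t + E i (\<lambda>z. tail_price v (t + fst z)) = E i (payoff (tail_price v) t)"
    by (simp add: ER_eq i E_add[symmetric] payoff_def[abs_def] split_beta)
  moreover have "tail_price v t = E i (\<lambda>z. (\<Sum>\<tau>\<in>{t..B}. v \<tau> * of_bool (fst z > \<tau> - t)) + tail_price v (t + fst z))"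
  proof -
    \<comment> \<open>A job of size \<open>s\<close> started at \<open>t\<close> occupies the steps
      with \<open>\<tau> - t < s\<close>; the other steps make up the tail from its completion
      on.\<close>
    have "(\<Sum>\<tau>\<in>{t..B}. v \<tau> * of_bool (s > \<tau> - t)) + tail_price v (t + s) = tail_price v t" for s
    proof -
      have "tail_price v (t + s) = (\<Sum>\<tau>\<in>{t..B}. v \<tau> * of_bool (\<not> s > \<tau> - t))"
        unfolding tail_price_def by (intro sum.mono_neutral_cong_left) auto
      moreover have "(\<Sum>\<tau>\<in>{t..B}. v \<tau> * of_bool (s > \<tau> - t)) + (\<Sum>\<tau>\<in>{t..B}. v \<tau> * of_bool (\<not> s > \<tau> - t))
          = (\<Sum>\<tau>\<in>{t..B}. v \<tau>)"
        unfolding sum.distrib[symmetric] by (intro sum.cong) auto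
      ultimately show ?thesis by (simp add: tail_price_def)
    qed
    then show ?thesis by simp
  qed
  moreover have "E i (\<lambda>z. \<Sum>\<tau>\<in>{t..B}. v \<tau> * of_bool (fst z > \<tau> - t)) = (\<Sum>\<tau>\<in>{t..B}. v \<tau> * size_tail I i (\<tau> - t))"
    unfolding E_sum[OF i] E_cmult E_tail ..
  ultimately show ?thesis
    using E_payoff_le[OF bal t i] by (simp add: E_add i)
qed

text \<open>Weak duality: bound each coefficient by its dual constraint, regroup the sums by machine
  constraint and by job, and apply the primal constraints.\<close>

lemma lp_objective_le:
  assumes bal: "balanced v b 1" and feas: "lp_feasible I x s"
  shows "lp_objective I x \<le> 2 * tail_price v 1"
proof -
  have nn: "0 \<le> v \<tau>" if "\<tau> \<in> {1..B}" for \<tau>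
    using balanced_nonneg[OF bal] that by blast
  have x0: "0 \<le> x i t" if "i < n" "t \<in> {1..B}" for i t
    using feas that by (auto simp: lp_feasible_def)
  have sum_x: "(\<Sum>t=1..B. x i t) \<le> 1" if i: "i < n" for i
  proof -
    have xs: "\<forall>t\<in>{1..B}. x i t \<le> s i t" using feas i unfolding lp_feasible_def by blast
    \<comment> \<open>The recurrence for \<open>s\<close> telescopes: \<open>s i k - x i k\<close>
      is what remains of the initial 1 after step \<open>k\<close>, and the second conjunct keeps it
      nonnegative.\<close>
    have *: "(\<Sum>t=1..k. x i t) \<le> 1 - (s i k - x i k) \<and> x i k \<le> s i k" if "1 \<le> k" "k \<le> B" for k
      using that
    proof (induction k rule: dec_induct)
      case base
      then have "x i 1 \<le> s i 1" using xs by simp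
      moreover have "s i 1 = 1" using feas i unfolding lp_feasible_def by blast
      ultimately show ?case by simp
    next
      case (step k)
      then have "s i (Suc k) = s i k - x i k" "x i (Suc k) \<le> s i (Suc k)"
        using feas i by (auto simp: lp_feasible_def dest!: bspec[where x="Suc k"])
      then show ?case using step by simp
    qed
    show ?thesis using *[of B] by (cases "B = 0") auto
  qed
  have "lp_objective I x \<le> (\<Sum>i<n. \<Sum>t=1..B. ((\<Sum>\<tau>\<in>{t..B}. v \<tau> * size_tail I i (\<tau> - t)) + job_price v b i 0) * x i t)"
    unfolding lp_objective_def
    by (intro sum_mono mult_right_mono ER_le[OF bal] x0) auto
  also have "\<dots> = (\<Sum>i<n. \<Sum>t=1..B. \<Sum>\<tau>\<in>{t..B}. v \<tau> * (x i t * size_tail I i (\<tau> - t)))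
      + (\<Sum>i<n. job_price v b i 0 * (\<Sum>t=1..B. x i t))"
    unfolding distrib_right sum.distrib sum_distrib_right sum_distrib_left by (simp add: mult_ac)
  also have "(\<Sum>i<n. \<Sum>t=1..B. \<Sum>\<tau>\<in>{t..B}. v \<tau> * (x i t * size_tail I i (\<tau> - t)))
    = (\<Sum>\<tau>=1..B. v \<tau> * (\<Sum>i<n. \<Sum>t=1..\<tau>. x i t * size_tail I i (\<tau> - t)))"
  proof -
    have "(\<Sum>t=1..B. \<Sum>\<tau>\<in>{t..B}. f t \<tau>) = (\<Sum>\<tau>=1..B. \<Sum>t=1..\<tau>. f t \<tau>)" for f :: "nat \<Rightarrow> nat \<Rightarrow> real"
      unfolding sum.Sigma[OF finite_atLeastAtMost ballI[OF finite_atLeastAtMost]]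
      by (rule sum.reindex_bij_witness[of _ prod.swap prod.swap]) auto
    then show ?thesis by (simp add: sum.swap[of _ "{..<n}"] sum_distrib_left)
  qed
  also have "\<dots> \<le> (\<Sum>\<tau>=1..B. v \<tau> * 1)"
    using feas nn by (intro sum_mono mult_left_mono) (auto simp: lp_feasible_def)
  also have "(\<Sum>i<n. job_price v b i 0 * (\<Sum>t=1..B. x i t)) \<le> (\<Sum>i<n. job_price v b i 0 * 1)"
    using sum_x by (intro sum_mono mult_left_mono job_price_nonneg[OF bal]) auto
  also have "\<dots> \<le> tail_price v 1"
    using job_price_total[OF bal] by simp
  finally show ?thesis by (simp add: tail_price_def)
qed

lemma OPT_LP_le: "balanced v b 1 \<Longrightarrow> OPT_LP I \<le> 2 * tail_price v 1"
  unfolding OPT_LP_def using lp_nonempty[of I] lp_objective_le by (intro cSup_least) blast+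

lemma OPT_LP_nonneg: "0 \<le> OPT_LP I"
  unfolding OPT_LP_def
proof (rule cSup_upper2[OF _ _ lp_bdd])
  show "lp_objective I (\<lambda>_ _. 0) \<in> {lp_objective I x | x s. lp_feasible I x s}"
    using lp_nonempty by blast
qed (simp add: lp_objective_def)

end

context knapsack begin

subsection \<open>Adaptive policies\<close>

text \<open>Reward in hand plus the dual objective of the residual problem: prices from the next
  free step on, and the totals of the jobs that can still be started.\<close>

definition potential :: "(nat \<Rightarrow> real) \<Rightarrow> (nat \<Rightarrow> nat) \<Rightarrow> env \<Rightarrow> real" where
  "potential v b e = (case e of (t, A, w) \<Rightarrow>
     w + tail_price v t + (\<Sum>i\<in>{..<n} - A. job_price v b i 0))"

definition proper :: "env \<Rightarrow> bool" where
  "proper e \<longleftrightarrow> 1 \<le> fst e \<and> 0 \<le> env_reward e"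

lemma proper_step:
  assumes "proper e" "y \<in> set_pmf (env_step I a e)"
  shows "proper (snd y)"
proof -
  obtain t A w where e: "e = (t, A, w)" by (cases e)
  consider (start) i s r where "i < n" "(s, r) \<in> set_pmf (job_pmf I i)"
      "snd y = (t + s, insert i A, w + of_rat r) \<or> snd y = (t + s, insert i A, w)"
    | (stay) "snd y = e" | (idle) "snd y = (t + 1, A, w)"
    using assms(2) by (cases a) (auto simp: e env_step_def split: if_splits)
  then show ?thesis
    using assms(1) by cases (auto simp: e proper_def env_reward_def dest: job_support_valid)
qed

lemma proper_play: "y \<in> set_pmf (play I \<pi> k) \<Longrightarrow> proper (snd y)"
proof (induction k arbitrary: y)
  case 0
  then show ?case by (simp add: proper_def init_env_def env_reward_def)
next
  case (Suc k)
  then obtain x a z where "x \<in> set_pmf (play I \<pi> k)" "z \<in> set_pmf (env_step I a (snd x))" "snd y = snd z"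
    by (auto simp: split_beta)
  then show ?case using Suc.IH proper_step by metis
qed

lemma tail_price_nonneg: "balanced v b 1 \<Longrightarrow> 1 \<le> t \<Longrightarrow> 0 \<le> tail_price v t"
  unfolding tail_price_def by (intro sum_nonneg) (auto simp: balanced_nonneg)

lemma tail_price_antimono: "balanced v b 1 \<Longrightarrow> 1 \<le> t \<Longrightarrow> tail_price v (Suc t) \<le> tail_price v t"
  unfolding tail_price_def by (intro sum_mono2) (auto simp: balanced_nonneg)

lemma reward_le_potential:
  assumes "balanced v b 1" "proper e"
  shows "0 \<le> env_reward e" "env_reward e \<le> potential v b e"
proof -
  have "0 \<le> (\<Sum>i\<in>A. job_price v b i 0)" for A
    by (intro sum_nonneg job_price_nonneg assms(1))
  then show "env_reward e \<le> potential v b e"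
    using assms tail_price_nonneg[OF assms(1)] by (cases e) (auto simp: potential_def proper_def env_reward_def)
qed (use assms in \<open>simp add: proper_def\<close>)

text \<open>Starting \<open>i\<close> releases the total of \<open>i\<close> and the prices down to
  the completion time, which together cover the expected reward; idling only drops a nonnegative
  price. Nonnegative integrals are used because a policy may randomize over infinitely many actions,
  and they compose without integrability conditions.\<close>

lemma potential_step:
  assumes bal: "balanced v b 1" and e: "proper e"
  shows "(\<integral>\<^sup>+ y. ennreal (potential v b (snd y)) \<partial>env_step I a e) \<le> ennreal (potential v b e)"
proof -
  obtain t A w where te: "e = (t, A, w)" by (cases e)
  have t1: "1 \<le> t" using e by (simp add: te proper_def)
 have "(\<exists>i. a = Start i \<and> i < n \<and> i \<notin> A \<and> t \<le> B) \<or> env_step I a e = return_pmf (None, e)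
      \<or> env_step I a e = return_pmf (None, (t + 1, A, w))"
    by (cases a) (auto simp: te env_step_def)
  then consider (start) i where "a = Start i" "i < n" "i \<notin> A" "t \<le> B"
    | (stay) "env_step I a e = return_pmf (None, e)"
    | (idle) "env_step I a e = return_pmf (None, (t + 1, A, w))"
    by blast
  then show ?thesis
  proof cases
    case start
    let ?M = "\<Sum>j\<in>{..<n} - insert i A. job_price v b j 0"
    have M: "(\<Sum>j\<in>{..<n} - A. job_price v b j 0) = job_price v b i 0 + ?M"
      using start by (subst sum.remove[of _ i]) (auto intro!: sum.cong)
    let ?next = "\<lambda>(s, r). if t + s - 1 \<le> B then (Some (s, r), (t + s, insert i A, w + of_rat r))
                else (None, (t + s, insert i A, w))"
    have nxt: "potential v b (snd (?next z)) = w + ?M + payoff (tail_price v) t z" for z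
      using t1 by (auto simp: potential_def payoff_def split: prod.split)
    have nonneg: "0 \<le> potential v b (snd (?next z))" if "z \<in> set_pmf (job_pmf I i)" for z
    proof -
      have "?next z \<in> set_pmf (env_step I a e)"
        using start that by (auto simp: te env_step_def)
      then show ?thesis using proper_step[OF e] reward_le_potential[OF bal] by (meson order_trans)
    qed
    have "(\<integral>\<^sup>+ y. ennreal (potential v b (snd y)) \<partial>env_step I a e)
      = (\<integral>\<^sup>+ z. ennreal (potential v b (snd (?next z))) \<partial>job_pmf I i)"
      using start by (simp add: te env_step_def)
    also have "\<dots> = ennreal (E i (\<lambda>z. potential v b (snd (?next z))))"
      unfolding E_def using nonneg
      by (intro nn_integral_eq_integral integrable_job start) (simp add: AE_measure_pmf_iff)
    also have "E i (\<lambda>z. potential v b (snd (?next z))) = w + ?M + E i (payoff (tail_price v) t)"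
      unfolding nxt using start by (simp add: E_add)
    also have "\<dots> \<le> potential v b e"
      using E_payoff_le[OF bal t1] start by (simp add: te potential_def M)
    finally show ?thesis by (simp add: ennreal_leI)
  next
    case idle
    then show ?thesis
      using tail_price_antimono[OF bal t1] by (simp add: te potential_def ennreal_leI)
  qed simp
qed

lemma policy_reward_le:
  assumes bal: "balanced v b 1"
  shows "policy_reward I \<pi> \<le> 2 * tail_price v 1"
proof -
  have inv: "(\<integral>\<^sup>+ y. ennreal (potential v b (snd y)) \<partial>play I \<pi> k) \<le> ennreal (potential v b init_env)" for k
  proof (induction k)
    case 0
    then show ?case by simp
  next
    case (Suc k)
    have "(\<integral>\<^sup>+ y. ennreal (potential v b (snd y)) \<partial>play I \<pi> (Suc k))
      = (\<integral>\<^sup>+ x. \<integral>\<^sup>+ a. \<integral>\<^sup>+ y. ennreal (potential v b (snd y)) \<partial>env_step I a (snd x) \<partial>\<pi> (fst x) \<partial>play I \<pi> k)"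
      by (simp add: split_beta)
    moreover have "\<dots> \<le> (\<integral>\<^sup>+ x. \<integral>\<^sup>+ a. ennreal (potential v b (snd x)) \<partial>\<pi> (fst x) \<partial>play I \<pi> k)"
      by (intro nn_integral_mono_AE, unfold AE_measure_pmf_iff)
        (intro ballI nn_integral_mono potential_step[OF bal], erule proper_play)
    moreover have "\<dots> = (\<integral>\<^sup>+ x. ennreal (potential v b (snd x)) \<partial>play I \<pi> k)"
      by simp
    ultimately show ?case using Suc by (simp add: order_trans)
  qed
  have init: "potential v b init_env \<le> 2 * tail_price v 1"
    using job_price_total[OF bal] by (simp add: potential_def init_env_def lessThan_def)
  have "(\<integral>\<^sup>+ y. ennreal (env_reward (snd y)) \<partial>play I \<pi> B)
    \<le> (\<integral>\<^sup>+ y. ennreal (potential v b (snd y)) \<partial>play I \<pi> B)"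
    using reward_le_potential[OF bal] proper_play[of _ \<pi> B]
    by (intro nn_integral_mono_AE) (auto simp: AE_measure_pmf_iff intro!: ennreal_leI)
  also have "\<dots> \<le> ennreal (2 * tail_price v 1)"
    using inv[of B] init by (meson ennreal_leI order_trans)
  finally show ?thesis
    unfolding policy_reward_def split_beta
    by (intro integral_real_bounded) (auto simp: tail_price_nonneg[OF bal])
qed

lemma OPT_policy_le: "balanced v b 1 \<Longrightarrow> OPT_policy I \<le> 2 * tail_price v 1"
  unfolding OPT_policy_def by (intro cSUP_least policy_reward_le) simp

lemma OPT_policy_nonneg: "0 \<le> OPT_policy I"
proof -
  have "0 \<le> policy_reward I \<pi>" for \<pi>
    unfolding policy_reward_def split_beta
    by (intro integral_nonneg_AE) (use proper_play in \<open>auto simp: AE_measure_pmf_iff proper_def\<close>)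
  then show ?thesis
    unfolding OPT_policy_def by (intro cSUP_upper2[OF policy_bdd[OF valid]]) auto
qed

end

section \<open>Reasoning about programs\<close>

subsection \<open>Guaranteed reward and time\<close>

text \<open>A certificate built backwards from halting configurations: every branch halts with
  computing time at most \<open>b\<close>, and the expected final reward is at least
  \<open>v\<close>. The function \<open>f\<close> records the guarantee for each successor. Being
  inductive, it can be composed command by command without counting machine steps.\<close>

inductive good :: "inst \<Rightarrow> nat \<Rightarrow> config \<Rightarrow> real \<Rightarrow> bool" for I b where
  halt: "T \<le> b \<Longrightarrow> v \<le> env_reward e \<Longrightarrow> good I b ([], m, e, T) v"
| step: "fst C \<noteq> [] \<Longrightarrow> (\<And>C'. C' \<in> set_pmf (step I C) \<Longrightarrow> good I b C' (f C')) \<Longrightarrow>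
    v \<le> measure_pmf.expectation (step I C) f \<Longrightarrow> good I b C v"

lemma good_det: "step I C = return_pmf C' \<Longrightarrow> fst C \<noteq> [] \<Longrightarrow> good I b C' v \<Longrightarrow> good I b C v"
  by (rule good.step[where f = "\<lambda>_. v"]) auto

definition delay :: "nat \<Rightarrow> config \<Rightarrow> config" where
  "delay d C = (case C of (cs, m, e, T) \<Rightarrow> (cs, m, e, T + d))"

lemma step_delay: "step I (delay d C) = map_pmf (delay d) (step I C)"
  by (cases "(I, C)" rule: step.cases) (auto simp: delay_def map_pmf_comp split_beta add_ac intro!: map_pmf_cong)

text \<open>The clock is written but never read, so a certificate for a later clock is also valid
  for an earlier one. All rounding up of costs goes through this.\<close>

lemma good_delay: "good I b (delay d C) v \<Longrightarrow> good I b C v"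
proof (induction "delay d C" v arbitrary: C rule: good.induct)
  case (halt T v e m)
  then obtain T' where "C = ([], m, e, T')" "T' \<le> T"
    by (cases C) (auto simp: delay_def)
  then show ?case using halt by (auto intro: good.halt)
next
  case (step f v)
  show ?case
  proof (rule good.step[where f = "\<lambda>C'. f (delay d C')"])
    show "fst C \<noteq> []" using step.hyps(1) by (cases C) (simp add: delay_def)
    show "v \<le> measure_pmf.expectation (Defs.step I C) (\<lambda>C'. f (delay d C'))"
      using step.hyps(4) by (simp add: step_delay)
    show "good I b C' (f (delay d C'))" if "C' \<in> set_pmf (Defs.step I C)" for C'
      using step.hyps(3)[of C'] that by (simp add: step_delay)
  qed
qed

lemma good_earlier: "good I b (cs, m, e, T) v \<Longrightarrow> T' \<le> T \<Longrightarrow> good I b (cs, m, e, T') v"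
  using good_delay[of I b "T - T'" "(cs, m, e, T')" v] by (simp add: delay_def)

section \<open>From certificates to the distribution of runs\<close>

definition steps :: "inst \<Rightarrow> nat \<Rightarrow> config pmf \<Rightarrow> config pmf" where
  "steps I k = ((\<lambda>p. p \<bind> step I) ^^ k)"

lemma steps_bind: "steps I k (p \<bind> f) = p \<bind> (\<lambda>C. steps I k (f C))"
  by (induction k) (simp_all add: steps_def bind_assoc_pmf)

text \<open>\<open>run\<close> appends steps at the end, whereas a certificate peels off the first
  one; associativity of bind mediates between the two.\<close>

lemma steps_Suc: "steps I (Suc k) (return_pmf C) = step I C \<bind> (\<lambda>C'. steps I k (return_pmf C'))"
  using steps_bind[of I k "step I C" return_pmf]
  by (simp add: steps_def funpow_Suc_right bind_return_pmf bind_return_pmf' del: funpow.simps)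

lemma run_steps: "run I P k = steps I k (return_pmf (init_config I P))"
  by (induction k) (simp_all add: steps_def)

lemma steps_halted: "steps I k (return_pmf ([], m, e, T)) = return_pmf ([], m, e, T)"
  by (induction k) (simp_all add: steps_def bind_return_pmf)

lemma finite_step:
  assumes "valid_inst I"
  shows "finite (set_pmf (step I C))"
proof -
  interpret knapsack I using assms by unfold_locales
  have "finite (set_pmf (env_step I a e))" for a e
    using finite_job by (cases a) (auto simp: env_step_def split: prod.splits)
  then show ?thesis by (cases "(I, C)" rule: step.cases) auto
qed

lemma finite_steps: "valid_inst I \<Longrightarrow> finite (set_pmf (steps I k (return_pmf C)))"
  by (induction k) (simp_all add: steps_def finite_step)

definition halted_by :: "nat \<Rightarrow> config \<Rightarrow> bool" where
  "halted_by b C \<longleftrightarrow> (case C of (cs, m, e, T) \<Rightarrow> cs = [] \<and> T \<le> b)"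

definition reward :: "config \<Rightarrow> real" where
  "reward C = (case C of (cs, m, e, T) \<Rightarrow> env_reward e)"

definition settled :: "inst \<Rightarrow> nat \<Rightarrow> config pmf \<Rightarrow> real \<Rightarrow> bool" where
  "settled I b p v \<longleftrightarrow> (\<forall>C \<in> set_pmf p. halted_by b C) \<and> v \<le> measure_pmf.expectation p reward"

text \<open>Every configuration has finitely many successors, so the maximum of their depths is a
  common depth. Halted configurations are fixed points, hence the claim holds for all larger
  \<open>k\<close> as well.\<close>

lemma good_steps:
  assumes "valid_inst I" "good I b C v"
  shows "\<exists>K. \<forall>k\<ge>K. settled I b (steps I k (return_pmf C)) v"
  using assms(2)
proof induction
  case (halt T v e m)
  then show ?case by (simp add: steps_halted settled_def halted_by_def reward_def)
next
  case (step C f v)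
  let ?S = "set_pmf (Defs.step I C)"
  obtain K where K: "\<And>C' k. C' \<in> ?S \<Longrightarrow> K C' \<le> k \<Longrightarrow> settled I b (steps I k (return_pmf C')) (f C')"
    using step.IH by metis
  have fin: "finite ?S" by (rule finite_step[OF assms(1)])
  have "settled I b (steps I k (return_pmf C)) v" if k: "Suc (Max (K ` ?S)) \<le> k" for k
  proof -
    obtain k' where k': "k = Suc k'" using k by (cases k) auto
    have IH: "settled I b (steps I k' (return_pmf C')) (f C')" if "C' \<in> ?S" for C'
    proof (rule K[OF that])
      have "K C' \<le> Max (K ` ?S)" using fin that by simp
      then show "K C' \<le> k'" using k unfolding k' by simp
    qed
    have "v \<le> (\<Sum>C'\<in>?S. pmf (Defs.step I C) C' *\<^sub>R f C')"
      using step.hyps(3) by (simp add: integral_measure_pmf[OF fin])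
    also have "\<dots> \<le> (\<Sum>C'\<in>?S. pmf (Defs.step I C) C' *\<^sub>R measure_pmf.expectation (steps I k' (return_pmf C')) reward)"
      using IH by (intro sum_mono scaleR_left_mono pmf_nonneg) (simp add: settled_def)
    also have "\<dots> = measure_pmf.expectation (steps I k (return_pmf C)) reward"
      unfolding k' steps_Suc
      by (rule pmf_expectation_bind[symmetric]) (simp_all add: fin finite_steps[OF assms(1)])
    finally show ?thesis using IH unfolding k' steps_Suc by (auto simp: settled_def)
  qed
  then show ?case by blast
qed

lemma good_correct:
  assumes "valid_inst I" "good I b (init_config I P) v" "real b \<le> b'"
  shows "runs_in_time I P b'" "v \<le> alg_reward I P"
proof -
  obtain K where K: "\<And>k. K \<le> k \<Longrightarrow> settled I b (run I P k) v"
    using good_steps[OF assms(1,2)] unfolding run_steps by blast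
  then have halted: "halted_by b C" if "K \<le> k" "C \<in> set_pmf (run I P k)" for C k
    using that unfolding settled_def by blast
  show "runs_in_time I P b'"
    unfolding runs_in_time_def
  proof (intro exI[of _ K] ballI)
    fix C assume "C \<in> set_pmf (run I P K)"
    then have "halted_by b C" using halted by blast
    then show "case C of (cs, m, e, T) \<Rightarrow> cs = [] \<and> real T \<le> b'"
      using assms(3) by (auto simp: halted_by_def split: prod.splits)
  qed
  have stable: "run I P (Suc k) = run I P k" if k: "K \<le> k" for k
  proof -
    have "run I P k \<bind> step I = run I P k \<bind> return_pmf"
    proof (rule bind_pmf_cong[OF refl])
      fix C assume "C \<in> set_pmf (run I P k)"
      then have "halted_by b C" using halted k by blast
      then show "step I C = return_pmf C" by (cases C) (simp add: halted_by_def)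
    qed
    then show ?thesis by (simp add: bind_return_pmf')
  qed
  have const: "run I P k = run I P K" if "K \<le> k" for k
    using that by (induction k rule: dec_induct) (simp_all only: stable)
  have "(\<lambda>k. measure_pmf.expectation (run I P k) reward) \<longlonglongrightarrow> measure_pmf.expectation (run I P K) reward"
    by (intro tendsto_eventually eventually_sequentiallyI[of K]) (rule arg_cong[OF const])
  moreover have "v \<le> measure_pmf.expectation (run I P K) reward"
    using K[of K] by (simp add: settled_def)
  moreover have "reward = (\<lambda>(cs, m, e, T). env_reward e)"
    by (auto simp: reward_def fun_eq_iff)
  ultimately show "v \<le> alg_reward I P"
    unfolding alg_reward_def by (simp add: limI)
qed

subsection \<open>Costs\<close>

definition bounded_mem :: "nat \<Rightarrow> mem \<Rightarrow> bool" where
  "bounded_mem W m \<longleftrightarrow> (\<forall>a. m a < 2 ^ W)"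

primrec expr_size :: "expr \<Rightarrow> nat" where
  "expr_size (Lit v) = 1 + bits v"
| "expr_size (Mem e) = 1 + expr_size e"
| "expr_size (Add e1 e2) = 1 + expr_size e1 + expr_size e2"
| "expr_size (Sub e1 e2) = 1 + expr_size e1 + expr_size e2"
| "expr_size (Mul e1 e2) = 1 + expr_size e1 + expr_size e2"
| "expr_size (Div e1 e2) = 1 + expr_size e1 + expr_size e2"

lemma bits_le_iff: "bits v \<le> k \<longleftrightarrow> v < 2 ^ k"
  by (auto simp: floorlog_le_iff)

lemma bits_add: "bits (v + w) \<le> 1 + bits v + bits w"
proof -
  have "v < 2 ^ bits v" "w < 2 ^ bits w" using bits_le_iff by blast+
  moreover have "(2::nat) ^ bits v \<le> 2 ^ (bits v + bits w)" "(2::nat) ^ bits w \<le> 2 ^ (bits v + bits w)"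
    by (intro power_increasing; simp)+
  ultimately have "v + w < 2 * 2 ^ (bits v + bits w)" by linarith
  then have "v + w < 2 ^ (1 + bits v + bits w)" by simp
  then show ?thesis by (simp only: bits_le_iff)
qed

lemma bits_mult: "bits (v * w) \<le> bits v + bits w"
proof -
  have "v < 2 ^ bits v" "w < 2 ^ bits w" using bits_le_iff by blast+
  then have "v * w < 2 ^ (bits v + bits w)"
    unfolding power_add by (intro mult_strict_mono') auto
  then show ?thesis by (simp only: bits_le_iff)
qed

text \<open>A read yields at most \<open>W\<close> bits, and an operation at most adds the lengths
  of its operands and one bit, so lengths grow linearly with the expression.\<close>

lemma bits_val: "bounded_mem W m \<Longrightarrow> bits (val m e) \<le> expr_size e * (W + 1)"
proof (induction e)
  case (Mem e)
  then have "bits (val m (Mem e)) \<le> W" by (simp add: bounded_mem_def bits_le_iff)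
  then show ?case by simp
next
  case (Add e1 e2)
  then show ?case using bits_add[of "val m e1" "val m e2"] by (simp add: algebra_simps)
next
  case (Sub e1 e2)
  then have "bits (val m (Sub e1 e2)) \<le> bits (val m e1)" by (simp add: floorlog_mono)
  then show ?case using Sub by (simp add: algebra_simps)
next
  case (Mul e1 e2)
  then show ?case using bits_mult[of "val m e1" "val m e2"] by (simp add: algebra_simps)
next
  case (Div e1 e2)
  then have "bits (val m (Div e1 e2)) \<le> bits (val m e1)" by (simp add: floorlog_mono)
  then show ?case using Div by (simp add: algebra_simps)
qed simp

lemma cost_le: "bounded_mem W m \<Longrightarrow> cost m e \<le> expr_size e * (1 + expr_size e * (W + 1))"
proof (induction e)
  case (Lit v)
  then show ?case by simp
next
  case (Mem e)
  then show ?case using bits_val[OF Mem.prems, of "Mem e"] 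
    by (simp add: algebra_simps del: val.simps)
next
  case (Add e1 e2)
  then show ?case using bits_val[OF Add.prems, of "Add e1 e2"]
    by (simp add: algebra_simps del: val.simps)
next
  case (Sub e1 e2)
  then show ?case using bits_val[OF Sub.prems, of "Sub e1 e2"]
    by (simp add: algebra_simps del: val.simps)
next
  case (Mul e1 e2)
  then show ?case using bits_val[OF Mul.prems, of "Mul e1 e2"]
    by (simp add: algebra_simps del: val.simps)
next
  case (Div e1 e2)
  then show ?case using bits_val[OF Div.prems, of "Div e1 e2"]
    by (simp add: algebra_simps del: val.simps)
qed

text \<open>An expression of size at most 200 costs at most
  \<open>200 * (1 + 200 * (W + 1)) \<le> 40200 * (W + 1)\<close>. The constant covers two of them,
  the command itself, and the three numbers that a launch reveals.\<close>

definition unit_cost :: "nat \<Rightarrow> nat" where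
  "unit_cost W = 100000 * (W + 1)"

lemma cost_small:
  assumes "bounded_mem W m" "expr_size e \<le> 200"
  shows "cost m e \<le> 40200 * (W + 1)"
proof -
  have "expr_size e * (1 + expr_size e * (W + 1)) \<le> 200 * (1 + 200 * (W + 1))"
    using assms(2) by (intro mult_le_mono add_left_mono) auto
  also have "\<dots> \<le> 40200 * (W + 1)" by simp
  finally show ?thesis using cost_le[OF assms(1), of e] by linarith
qed

lemma unit_cost_pos: "1 \<le> unit_cost W"
  by (simp add: unit_cost_def)

lemma cost_small2:
  assumes "bounded_mem W m" "expr_size a \<le> 200" "expr_size e \<le> 200"
  shows "1 + cost m a + cost m e \<le> unit_cost W"
proof -
  have "1 + cost m a + cost m e \<le> 1 + 40200 * (W + 1) + 40200 * (W + 1)"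
    using cost_small assms by (intro add_mono) auto
  also have "\<dots> \<le> unit_cost W" by (simp add: unit_cost_def)
  finally show ?thesis .
qed

lemma cost_small1:
  assumes "bounded_mem W m" "expr_size a \<le> 200"
  shows "1 + cost m a \<le> unit_cost W"
  using cost_small2[OF assms assms(2)] by linarith

subsection \<open>Deterministic execution\<close>

text \<open>Continuation style: a certificate after \<open>c\<close> yields one before
  \<open>c\<close>, whatever commands follow and whatever the state of the process. So deterministic
  code is verified independently of rewards, with time in units of
  \<open>unit_cost W\<close>.\<close>

definition exec :: "nat \<Rightarrow> com \<Rightarrow> mem \<Rightarrow> mem \<Rightarrow> nat \<Rightarrow> bool" where
  "exec W c m m' k \<longleftrightarrow> (\<forall>I b cs e T v. good I b (cs, m', e, T + k * unit_cost W) v \<longrightarrow> good I b (c # cs, m, e, T) v)"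

lemma execI:
  "(\<And>I b cs e T v. good I b (cs, m', e, T + k * unit_cost W) v \<Longrightarrow> good I b (c # cs, m, e, T) v) \<Longrightarrow>
    exec W c m m' k"
  unfolding exec_def by (intro allI impI)

lemma execD:
  "exec W c m m' k \<Longrightarrow> good I b (cs, m', e, T + k * unit_cost W) v \<Longrightarrow> good I b (c # cs, m, e, T) v"
  unfolding exec_def by (drule spec[of _ I], drule spec[of _ b], drule spec[of _ cs], drule spec[of _ e],
      drule spec[of _ T], drule spec[of _ v], erule mp)

lemma exec_mono: "exec W c m m' k \<Longrightarrow> k \<le> k' \<Longrightarrow> exec W c m m' k'"
  by (rule execI, erule execD, erule good_earlier) simp

lemma exec_Seq:
  assumes "exec W c1 m m1 k1" "exec W c2 m1 m2 k2"
  shows "exec W (Seq c1 c2) m m2 (1 + k1 + k2)"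
proof (rule execI)
  fix I b cs e T v
  assume "good I b (cs, m2, e, T + (1 + k1 + k2) * unit_cost W) v"
  then have "good I b (cs, m2, e, ((T + 1) + k1 * unit_cost W) + k2 * unit_cost W) v"
    by (rule good_earlier) (use unit_cost_pos[of W] in \<open>simp add: add_mult_distrib\<close>)
  then have "good I b (c1 # c2 # cs, m, e, T + 1) v" by (intro execD[OF assms(1)] execD[OF assms(2)])
  then show "good I b (Seq c1 c2 # cs, m, e, T) v" by (rule good_det[rotated 2]) simp_all
qed

lemma exec_Loop_exit:
  assumes "bounded_mem W m" "expr_size b \<le> 200" "val m b = 0"
  shows "exec W (Loop b c) m m 1"
proof (rule execI)
  fix I b' cs e T v
  assume "good I b' (cs, m, e, T + 1 * unit_cost W) v"
  then have "good I b' (cs, m, e, T + 1 + cost m b) v"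
    by (rule good_earlier) (use cost_small1[OF assms(1,2)] in \<open>simp add: add_mult_distrib\<close>)
  then show "good I b' (Loop b c # cs, m, e, T) v"
    by (rule good_det[rotated 2]) (simp_all add: assms)
qed

lemma exec_Loop_step:
  assumes "bounded_mem W m" "expr_size b \<le> 200" "val m b \<noteq> 0"
    and "exec W c m m1 k1" "exec W (Loop b c) m1 m2 k2"
  shows "exec W (Loop b c) m m2 (1 + k1 + k2)"
proof (rule execI)
  fix I b' cs e T v
  assume "good I b' (cs, m2, e, T + (1 + k1 + k2) * unit_cost W) v"
  then have "good I b' (cs, m2, e, ((T + 1 + cost m b) + k1 * unit_cost W) + k2 * unit_cost W) v"
    by (rule good_earlier) (use cost_small1[OF assms(1,2)] in \<open>simp add: add_mult_distrib\<close>)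
  then have "good I b' (c # Loop b c # cs, m, e, T + 1 + cost m b) v"
    by (intro execD[OF assms(4)] execD[OF assms(5)])
  then show "good I b' (Loop b c # cs, m, e, T) v"
    by (rule good_det[rotated 2]) (simp_all add: assms)
qed

text \<open>The invariant carries the number of completed iterations, which fixes both the number of
  rounds and the moment of exit. The final memory is existential, since only the invariant describes
  it.\<close>

lemma exec_Loop:
  assumes step: "\<And>a m. a < N \<Longrightarrow> Inv a m \<Longrightarrow> val m b \<noteq> 0 \<and> (\<exists>m'. exec W c m m' k \<and> Inv (Suc a) m')"
    and exit: "\<And>m. Inv N m \<Longrightarrow> val m b = 0"
    and bnd: "\<And>a m. a \<le> N \<Longrightarrow> Inv a m \<Longrightarrow> bounded_mem W m"
    and b: "expr_size b \<le> 200" and init: "Inv 0 m"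
  shows "\<exists>m'. exec W (Loop b c) m m' (N * (k + 1) + 1) \<and> Inv N m'"
proof -
  have "\<exists>m'. exec W (Loop b c) m m' ((N - a) * (k + 1) + 1) \<and> Inv N m'" if "a \<le> N" "Inv a m" for a m
    using that
  proof (induction a arbitrary: m rule: inc_induct)
    case base
    then show ?case using exec_Loop_exit[OF bnd b exit] by auto
  next
    case (step a)
    obtain m1 where m1: "val m b \<noteq> 0" "exec W c m m1 k" "Inv (Suc a) m1"
      using assms(1) step by blast
    obtain m2 where m2: "exec W (Loop b c) m1 m2 ((N - Suc a) * (k + 1) + 1)" "Inv N m2"
      using step.IH[OF m1(3)] by blast
    have "exec W (Loop b c) m m2 (1 + k + ((N - Suc a) * (k + 1) + 1))"
      using step by (intro exec_Loop_step[OF bnd b m1(1,2) m2(1), of a]) simp_all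
    moreover have "1 + k + ((N - Suc a) * (k + 1) + 1) = (N - a) * (k + 1) + 1"
    proof -
      have "N - a = Suc (N - Suc a)" using step by simp
      then show ?thesis by simp
    qed
    ultimately show ?case using m2(2) by auto
  qed
  from this[of 0 m] show ?thesis using init by simp
qed

section \<open>Symbolic execution of loop-free code\<close>

fun straight :: "com \<Rightarrow> bool" where
  "straight (Assign a e) \<longleftrightarrow> expr_size a \<le> 200 \<and> expr_size e \<le> 200"
| "straight (Seq c1 c2) \<longleftrightarrow> straight c1 \<and> straight c2"
| "straight (Cond b c1 c2) \<longleftrightarrow> expr_size b \<le> 200 \<and> straight c1 \<and> straight c2"
| "straight _ \<longleftrightarrow> False"

primrec result :: "com \<Rightarrow> mem \<Rightarrow> mem" where
  "result (Assign a e) m = m(val m a := val m e)"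
| "result (Seq c1 c2) m = result c2 (result c1 m)"
| "result (Cond b c1 c2) m = (if val m b \<noteq> 0 then result c1 m else result c2 m)"
| "result (Loop b c) m = m"
| "result (Flip a) m = m"
| "result (Launch b a) m = m"
| "result Wait m = m"

text \<open>Only assigned values are constrained; the intermediate values of an expression are
  controlled by its size.\<close>

primrec fits :: "nat \<Rightarrow> com \<Rightarrow> mem \<Rightarrow> bool" where
  "fits W (Assign a e) m \<longleftrightarrow> val m e < 2 ^ W"
| "fits W (Seq c1 c2) m \<longleftrightarrow> fits W c1 m \<and> fits W c2 (result c1 m)"
| "fits W (Cond b c1 c2) m \<longleftrightarrow> (if val m b \<noteq> 0 then fits W c1 m else fits W c2 m)"
| "fits W (Loop b c) m \<longleftrightarrow> True"
| "fits W (Flip a) m \<longleftrightarrow> True"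
| "fits W (Launch b a) m \<longleftrightarrow> True"
| "fits W Wait m \<longleftrightarrow> True"

text \<open>For a branch both alternatives are counted, which makes the bound independent of the
  memory.\<close>

fun num_steps :: "com \<Rightarrow> nat" where
  "num_steps (Assign a e) = 1"
| "num_steps (Seq c1 c2) = 1 + num_steps c1 + num_steps c2"
| "num_steps (Cond b c1 c2) = 1 + num_steps c1 + num_steps c2"
| "num_steps _ = 0"

lemma exec_straight:
  "straight c \<Longrightarrow> bounded_mem W m \<Longrightarrow> fits W c m \<Longrightarrow>
     exec W c m (result c m) (num_steps c) \<and> bounded_mem W (result c m)"
proof (induction c arbitrary: m)
  case (Assign a e)
  have "exec W (Assign a e) m (m(val m a := val m e)) 1"
  proof (rule execI)
    fix I b cs en T v
    assume "good I b (cs, m(val m a := val m e), en, T + 1 * unit_cost W) v"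
    then have "good I b (cs, m(val m a := val m e), en, T + 1 + cost m a + cost m e) v"
      by (rule good_earlier)
        (use cost_small2[OF Assign.prems(2), of a e] Assign.prems(1) in simp)
    then show "good I b (Assign a e # cs, m, en, T) v" by (rule good_det[rotated 2]) simp_all
  qed
  moreover have "bounded_mem W (m(val m a := val m e))"
    using Assign by (simp add: bounded_mem_def)
  ultimately show ?case unfolding result.simps num_steps.simps ..
next
  case (Seq c1 c2)
  then have 1: "exec W c1 m (result c1 m) (num_steps c1)" "bounded_mem W (result c1 m)" by simp_all
  with Seq have "exec W c2 (result c1 m) (result c2 (result c1 m)) (num_steps c2)"
    "bounded_mem W (result c2 (result c1 m))" by simp_all
  then show ?case using exec_Seq[OF 1(1)] by simp
next
  case (Cond b c1 c2)
  let ?c = "if val m b \<noteq> 0 then c1 else c2"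
  have *: "exec W ?c m (result ?c m) (num_steps ?c) \<and> bounded_mem W (result ?c m)"
    using Cond by simp
  have "exec W (Cond b c1 c2) m (result ?c m) (1 + num_steps ?c)"
  proof (rule execI)
    fix I b' cs e T v
    assume "good I b' (cs, result ?c m, e, T + (1 + num_steps ?c) * unit_cost W) v"
    then have "good I b' (cs, result ?c m, e, T + 1 + cost m b + num_steps ?c * unit_cost W) v"
      by (rule good_earlier) (use cost_small1[OF Cond.prems(2), of b] Cond.prems(1) in \<open>simp add: add_mult_distrib\<close>)
    then have "good I b' (?c # cs, m, e, T + 1 + cost m b) v"
      by (rule execD[OF conjunct1[OF *]])
    then show "good I b' (Cond b c1 c2 # cs, m, e, T) v" by (rule good_det[rotated 2]) simp_all
  qed
  then have "exec W (Cond b c1 c2) m (result ?c m) (num_steps (Cond b c1 c2))"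
    by (rule exec_mono) simp
  moreover have "result (Cond b c1 c2) m = result ?c m" by simp
  ultimately show ?case using * by metis
qed simp_all

section \<open>The program\<close>

subsection \<open>Memory layout\<close>

text \<open>
  Cell 1, which initially holds the number of jobs, is overwritten with the length \<open>q\<close> of the input.
  The input is followed by 16 registers and three interleaved arrays.
\<close>

definition layout :: "nat list \<Rightarrow> (nat \<Rightarrow> nat) \<Rightarrow> (nat \<Rightarrow> nat) \<Rightarrow> (nat \<Rightarrow> nat) \<Rightarrow> (nat \<Rightarrow> nat) \<Rightarrow> mem" where
  "layout inp R h b u a =
    (if a = 1 then length inp else if a < length inp then inp ! a
     else if a < length inp + 16 then R (a - length inp)
     else (let d = a - length inp - 16 in
       if d mod 3 = 0 then h (d div 3) else if d mod 3 = 1 then b (d div 3) else u (d div 3)))"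

definition reg_addr :: "nat \<Rightarrow> expr" where
  "reg_addr k = Add (Mem (Lit 1)) (Lit k)"

text \<open>The residue modulo 3 selects the array. Interleaving spares the program from reserving a
  length for any of them.\<close>

definition cell_addr :: "nat \<Rightarrow> expr \<Rightarrow> expr" where
  "cell_addr r e = Add (Add (Mem (Lit 1)) (Lit (16 + r))) (Mul (Lit 3) e)"

abbreviation reg :: "nat \<Rightarrow> expr" where
  "reg k \<equiv> Mem (reg_addr k)"

abbreviation cell :: "nat \<Rightarrow> expr \<Rightarrow> expr" where
  "cell r e \<equiv> Mem (cell_addr r e)"

definition set_reg :: "nat \<Rightarrow> expr \<Rightarrow> com" where
  "set_reg k e = Assign (reg_addr k) e"

definition set_cell :: "nat \<Rightarrow> expr \<Rightarrow> expr \<Rightarrow> com" where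
  "set_cell r i e = Assign (cell_addr r i) e"

lemma bits_numerals:
  "bits 0 = 0" "bits (Suc 0) = 1" "bits 1 = 1" "bits 2 = 2" "bits 3 = 2" "bits 4 = 3" "bits 5 = 3" "bits 6 = 3"
  "bits 7 = 3" "bits 8 = 4" "bits 9 = 4" "bits 10 = 4" "bits 15 = 4" "bits 16 = 5" "bits 17 = 5" "bits 18 = 5"
  by (simp_all add: compute_floorlog)

lemma bits_small: "v < 32 \<Longrightarrow> bits v \<le> 5"
  by (simp add: bits_le_iff)

lemma expr_size_reg_addr [simp]: "k < 16 \<Longrightarrow> expr_size (reg_addr k) \<le> 10"
  using bits_small[of k] bits_small[of 1] bits_numerals by (simp add: reg_addr_def)

lemma expr_size_cell_addr: "r < 3 \<Longrightarrow> expr_size (cell_addr r e) \<le> 19 + expr_size e"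
  using bits_small[of "16 + r"] bits_small[of 1] bits_small[of 3] bits_numerals by (simp add: cell_addr_def)

context
  fixes inp :: "nat list"
  assumes inp: "2 \<le> length inp"
begin

lemma layout_simps [simp]:
  "layout inp R h b u 0 = inp ! 0"
  "layout inp R h b u (Suc 0) = length inp"
  using inp by (auto simp: layout_def)

lemma val_reg_addr: "val (layout inp R h b u) (reg_addr k) = length inp + k"
  by (simp add: reg_addr_def)

lemma val_cell_addr: "val (layout inp R h b u) (cell_addr r e) = length inp + 16 + r + 3 * val (layout inp R h b u) e"
  by (simp add: cell_addr_def)

lemma val_reg [simp]: "k < 16 \<Longrightarrow> val (layout inp R h b u) (reg k) = R k"
  using inp by (simp add: val_reg_addr) (simp add: layout_def)

lemma layout_array:
  assumes "\<not> a < length inp + 16" "a \<noteq> 1" "d = a - length inp - 16"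
  shows "layout inp R h b u a = (if d mod 3 = 0 then h (d div 3) else if d mod 3 = 1 then b (d div 3) else u (d div 3))"
  using assms by (simp add: layout_def Let_def)

lemma layout_cell:
  assumes "r < 3"
  shows "layout inp R h b u (length inp + 16 + r + 3 * i) = (if r = 0 then h i else if r = 1 then b i else u i)"
proof -
  have *: "(r + 3 * i) mod 3 = r" "(r + 3 * i) div 3 = i" using assms by auto
  have "layout inp R h b u (length inp + 16 + r + 3 * i) =
    (if (r + 3 * i) mod 3 = 0 then h ((r + 3 * i) div 3)
     else if (r + 3 * i) mod 3 = 1 then b ((r + 3 * i) div 3) else u ((r + 3 * i) div 3))"
    by (rule layout_array) (use inp in auto)
  then show ?thesis unfolding * .
qed

lemma val_cell [simp]:
  "val (layout inp R h b u) (cell 0 e) = h (val (layout inp R h b u) e)"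
  "val (layout inp R h b u) (cell 1 e) = b (val (layout inp R h b u) e)"
  "val (layout inp R h b u) (cell (Suc 0) e) = b (val (layout inp R h b u) e)"
  "val (layout inp R h b u) (cell 2 e) = u (val (layout inp R h b u) e)"
  unfolding val.simps(2) val_cell_addr
  by (subst layout_cell; simp)+

lemma layout_upd_reg: "k < 16 \<Longrightarrow> (layout inp R h b u)(length inp + k := v) = layout inp (R(k := v)) h b u"
  using inp by (auto simp: layout_def fun_eq_iff)

text \<open>Quotient and remainder by 3 determine a cell, so a write to one array leaves the other
  two alone.\<close>

lemma layout_upd_cell:
  "(layout inp R h b u)(length inp + 16 + 3 * i := v) = layout inp R (h(i := v)) b u"
  "(layout inp R h b u)(length inp + 16 + 1 + 3 * i := v) = layout inp R h (b(i := v)) u"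
  "(layout inp R h b u)(length inp + 16 + 2 + 3 * i := v) = layout inp R h b (u(i := v))"
proof -
  have *: "(layout inp R h b u)(length inp + 16 + r + 3 * i := v) =
     layout inp R (if r = 0 then h(i := v) else h) (if r = 1 then b(i := v) else b) (if r = 2 then u(i := v) else u)"
    if r: "r < 3" for r
  proof
    fix a
    show "((layout inp R h b u)(length inp + 16 + r + 3 * i := v)) a =
      layout inp R (if r = 0 then h(i := v) else h) (if r = 1 then b(i := v) else b) (if r = 2 then u(i := v) else u) a"
    proof (cases "a < length inp + 16 \<or> a = 1")
      case True
      then show ?thesis using inp by (auto simp: layout_def)
    next
      case False
      define d where "d = a - length inp - 16"
      have "d = 3 * (d div 3) + d mod 3" by simp
      moreover have "a = length inp + 16 + d" using False by (simp add: d_def)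
      ultimately have eq: "a = length inp + 16 + r + 3 * i \<longleftrightarrow> d mod 3 = r \<and> d div 3 = i"
        using r by auto
      have lay: "layout inp R h b u a = (if d mod 3 = 0 then h (d div 3) else if d mod 3 = 1 then b (d div 3) else u (d div 3))"
        for h b u
        using False by (intro layout_array d_def) auto
      have "d mod 3 < 3" by simp
      then have "d mod 3 = 0 \<or> d mod 3 = 1 \<or> d mod 3 = 2" by linarith
      then show ?thesis unfolding fun_upd_apply eq lay by (elim disjE) auto
    qed
  qed
  from *[of 0] *[of 1] *[of 2] show
    "(layout inp R h b u)(length inp + 16 + 3 * i := v) = layout inp R (h(i := v)) b u"
    "(layout inp R h b u)(length inp + 16 + 1 + 3 * i := v) = layout inp R h (b(i := v)) u"
    "(layout inp R h b u)(length inp + 16 + 2 + 3 * i := v) = layout inp R h b (u(i := v))"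
    by simp_all
qed

lemma result_set_reg [simp]:
  "k < 16 \<Longrightarrow> result (set_reg k e) (layout inp R h b u) = layout inp (R(k := val (layout inp R h b u) e)) h b u"
  unfolding set_reg_def result.simps val_reg_addr by (rule layout_upd_reg)

lemma result_set_cell [simp]:
  "result (set_cell 0 i e) (layout inp R h b u) =
     layout inp R (h(val (layout inp R h b u) i := val (layout inp R h b u) e)) b u"
  "result (set_cell (Suc 0) i e) (layout inp R h b u) =
     layout inp R h (b(val (layout inp R h b u) i := val (layout inp R h b u) e)) u"
  "result (set_cell 2 i e) (layout inp R h b u) =
     layout inp R h b (u(val (layout inp R h b u) i := val (layout inp R h b u) e))"
  unfolding set_cell_def result.simps val_cell_addr using layout_upd_cell[of R h b u] by simp_all

lemma bounded_layout:
  assumes "\<And>a. a < length inp \<Longrightarrow> inp ! a < 2 ^ W" "length inp < 2 ^ W" "\<And>k. R k < 2 ^ W"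
    "\<And>k. h k < 2 ^ W" "\<And>k. b k < 2 ^ W" "\<And>k. u k < 2 ^ W"
  shows "bounded_mem W (layout inp R h b u)"
  using assms by (simp add: bounded_mem_def layout_def Let_def)

end

lemma set_reg_props [simp]:
  "k < 16 \<Longrightarrow> straight (set_reg k e) \<longleftrightarrow> expr_size e \<le> 200"
  "fits W (set_reg k e) m \<longleftrightarrow> val m e < 2 ^ W"
  "num_steps (set_reg k e) = 1"
  using expr_size_reg_addr[of k] by (auto simp: set_reg_def simp del: expr_size_reg_addr)

lemma set_cell_props [simp]:
  "r < 3 \<Longrightarrow> expr_size i \<le> 50 \<Longrightarrow> straight (set_cell r i e) \<longleftrightarrow> expr_size e \<le> 200"
  "fits W (set_cell r i e) m \<longleftrightarrow> val m e < 2 ^ W"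
  "num_steps (set_cell r i e) = 1"
  using expr_size_cell_addr[of r i] by (auto simp: set_cell_def)

subsection \<open>The code\<close>

abbreviation "input_end \<equiv> Mem (Lit 1)"
abbreviation "time_budget \<equiv> Mem (Lit 0)"
abbreviation "denom \<equiv> reg 0"
abbreviation "factor \<equiv> reg 1"
abbreviation "now \<equiv> reg 2"
abbreviation "ptr \<equiv> reg 3"
abbreviation "atoms_left \<equiv> reg 4"
abbreviation "job \<equiv> reg 5"
abbreviation "score \<equiv> reg 6"
abbreviation "best \<equiv> reg 7"
abbreviation "best_job \<equiv> reg 8"
abbreviation "idx \<equiv> reg 9"
abbreviation "duration \<equiv> reg 10"

text \<open>The language has no empty command; register 15 serves as a dump.\<close>

definition skip :: com where
  "skip = set_reg 15 (Lit 0)"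

definition decr :: "nat \<Rightarrow> com" where
  "decr k = set_reg k (Sub (reg k) (Lit 1))"

text \<open>Every job has at least one atom, so the first 0 in the position of a job header ends the input.\<close>

definition locate_end :: com where
  "locate_end = Seq (Assign (Lit 1) (Lit 2))
     (Loop (Mem input_end) (Assign (Lit 1) (Add (Add input_end (Lit 1)) (Mul (Lit 5) (Mem input_end)))))"

text \<open>The product of all positive input cells is a common denominator of all rationals in the input.\<close>

definition scale_step :: com where
  "scale_step = Seq (decr 9) (Cond (Mem idx) (set_reg 0 (Mul denom (Mem idx))) skip)"

definition find_scale :: com where
  "find_scale = Seq (set_reg 0 (Lit 1)) (Seq (set_reg 9 input_end) (Loop idx scale_step))"

text \<open>The division is exact: the denominator is a positive input cell and therefore divides
  \<open>denom\<close>. From \<open>ptr\<close> on, an atom occupies five cells: size, then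
  numerator and denominator of the reward and of the probability.\<close>

definition scaled_prob :: expr where
  "scaled_prob = Div (Mul (Mem (Add ptr (Lit 3))) denom) (Mem (Add ptr (Lit 4)))"

definition scaled_reward :: expr where
  "scaled_reward = Div (Mul (Mem (Add ptr (Lit 1))) denom) (Mem (Add ptr (Lit 2)))"

text \<open>With \<open>factor\<close> equal to the \<open>a\<close>-th power of
  \<open>denom\<close>, the scaled reward times \<open>factor\<close> carries the power
  \<open>a + 1\<close>, the same as the array of remaining prices; the probability adds one
  more.\<close>

definition atom_term :: expr where
  "atom_term = Mul scaled_prob (Add (Mul scaled_reward factor) (cell 0 (Add now (Mem ptr))))"

definition atom_step :: com where
  "atom_step = Seq
     (Cond (Sub (Add now (Mem ptr)) (Add time_budget (Lit 1))) skip (set_reg 6 (Add score atom_term)))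
     (Seq (set_reg 3 (Add ptr (Lit 5))) (decr 4))"

text \<open>\<open>score\<close> carries one power of \<open>denom\<close> more than the arrays,
  hence the multiplication. Truncated subtraction yields the positive part of the gain.\<close>

definition scaled_gain :: expr where
  "scaled_gain = Sub score (Mul denom (Add (cell 0 (Add now (Lit 1))) (cell 2 job)))"

definition job_start :: com where
  "job_start = Seq (set_reg 4 (Mem ptr)) (Seq (set_reg 3 (Add ptr (Lit 1))) (set_reg 6 (Lit 0)))"

definition job_finish :: com where
  "job_finish = Seq (Cond (Sub scaled_gain best) (Seq (set_reg 8 job) (set_reg 7 scaled_gain)) skip)
     (set_reg 5 (Add job (Lit 1)))"

definition job_step :: com where
  "job_step = Seq job_start (Seq (Loop atoms_left atom_step) job_finish)"

definition rescale_step :: com where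
  "rescale_step = Seq (decr 9) (Seq (set_cell 0 idx (Mul (cell 0 idx) denom)) (set_cell 2 idx (Mul (cell 2 idx) denom)))"

text \<open>Nonzero entries have a time index of at most \<open>B\<close> or a job index of at most
  \<open>q\<close>, so this many cells of each array suffice.\<close>

definition rescale :: com where
  "rescale = Seq (set_reg 9 (Add input_end (Add time_budget (Lit 2)))) (Loop idx rescale_step)"

definition time_start :: com where
  "time_start = Seq (set_reg 7 (Lit 0)) (Seq (set_reg 8 input_end) (Seq (set_reg 5 (Lit 0)) (set_reg 3 (Lit 2))))"

text \<open>\<open>best\<close> already has the scale of the coming round, so it is added only to
  arrays that have been rescaled.\<close>

definition time_finish :: com where
  "time_finish = Seq (set_reg 1 (Mul factor denom))
     (Seq (set_cell 0 now (Add (cell 0 (Add now (Lit 1))) best))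
     (Seq (set_cell 2 best_job (Add (cell 2 best_job) best))
     (Seq (set_cell 1 now best_job) (decr 2))))"

definition time_step :: com where
  "time_step = Seq time_start (Seq (Loop (Sub input_end ptr) job_step) (Seq rescale time_finish))"

definition make_plan :: com where
  "make_plan = Seq (set_reg 1 (Lit 1)) (Seq (set_reg 2 time_budget) (Loop now time_step))"

text \<open>
  Launching a job that was started before, or a number that is not a job, idles for one time step; like a job
  that overruns the budget it reveals duration 0.
\<close>

definition act :: com where
  "act = Seq (Launch (cell 1 now) (reg_addr 10))
     (set_reg 2 (Add now (Add duration (Sub (Lit 1) duration))))"

definition follow_plan :: com where
  "follow_plan = Seq (set_reg 2 (Lit 1)) (Loop (Sub (Add time_budget (Lit 1)) now) act)"

definition program :: com where
  "program = Seq locate_end (Seq find_scale (Seq make_plan follow_plan))"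

lemma straight_code [simp]:
  "straight scale_step" "straight atom_step" "straight job_start" "straight job_finish"
  "straight rescale_step" "straight time_start" "straight time_finish"
  by (simp_all add: scale_step_def atom_step_def job_start_def job_finish_def rescale_step_def time_start_def
    time_finish_def decr_def skip_def scaled_gain_def atom_term_def scaled_prob_def scaled_reward_def
    set_reg_def set_cell_def reg_addr_def cell_addr_def bits_numerals)

subsection \<open>The input\<close>

lemma nth_concat_offset:
  "i < length xss \<Longrightarrow> k < length (xss ! i) \<Longrightarrow> concat xss ! ((\<Sum>j<i. length (xss ! j)) + k) = xss ! i ! k"
proof (induction xss arbitrary: i)
  case (Cons xs xss)
  then show ?case
    by (cases i) (simp_all add: nth_append sum.lessThan_Suc_shift del: sum.lessThan_Suc)
qed simp

lemma length_concat_offset: "length (concat xss) = (\<Sum>j<length xss. length (xss ! j))"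
  by (simp add: length_concat sum_list_sum_nth atLeast0LessThan)

definition num :: "rat \<Rightarrow> nat" where
  "num r = nat (fst (quotient_of r))"

definition den :: "rat \<Rightarrow> nat" where
  "den r = nat (snd (quotient_of r))"

lemma rat_code_eq: "rat_code r = [num r, den r]"
  by (simp add: rat_code_def num_def den_def split: prod.split)

lemma den_pos: "0 < den r"
  using quotient_of_denom_pos'[of r] by (simp add: den_def)

lemma of_rat_num_den: "0 \<le> r \<Longrightarrow> (of_rat r :: real) = real (num r) / real (den r)"
proof -
  assume r: "0 \<le> r"
  obtain a b where ab: "quotient_of r = (a, b)" by force
  have b: "b > 0" and rab: "r = of_int a / of_int b"
    using quotient_of_denom_pos[OF ab] quotient_of_div[OF ab] by auto
  then have "a \<ge> 0" using r by (auto simp: zero_le_divide_iff)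
  moreover have "num r = nat a" "den r = nat b" by (simp_all add: num_def den_def ab)
  moreover have "(of_rat r :: real) = of_int a / of_int b" by (simp add: rab of_rat_divide)
  ultimately show ?thesis using b by simp
qed

lemma length_job_code: "length (job_code xs) = 1 + 5 * length xs"
proof -
  have "length (concat (map (\<lambda>(s, r, p). s # rat_code r @ rat_code p) xs)) = 5 * length xs"
    by (induction xs) (auto simp: rat_code_eq)
  then show ?thesis by (simp add: job_code_def)
qed

lemma job_code_0: "job_code xs ! 0 = length xs"
  by (simp add: job_code_def)

lemma job_code_atom:
  assumes "a < length xs" "xs ! a = (s, r, p)" "k < 5"
  shows "job_code xs ! (1 + 5 * a + k) = [s, num r, den r, num p, den p] ! k"
proof -
  let ?xss = "map (\<lambda>(s, r, p). s # rat_code r @ rat_code p) xs"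
  have "(\<Sum>j<a. length (?xss ! j)) = (\<Sum>j<a. 5)"
    using assms(1) by (intro sum.cong) (auto simp: rat_code_eq split: prod.splits)
  then show ?thesis
    using nth_concat_offset[of a ?xss k] assms by (simp add: job_code_def rat_code_eq mult.commute[of _ 5])
qed

context knapsack
begin

abbreviation "inp \<equiv> inst_code I"
abbreviation "q \<equiv> length inp"

section \<open>Positions of jobs and atoms in the encoded input\<close>

definition offset :: "nat \<Rightarrow> nat" where
  "offset i = 2 + (\<Sum>j<i. 1 + 5 * length (jobs I ! j))"

lemma offset_0 [simp]: "offset 0 = 2"
  by (simp add: offset_def)

lemma offset_ge: "2 \<le> offset i"
  by (simp add: offset_def)

lemma offset_Suc: "offset (Suc i) = offset i + 1 + 5 * length (jobs I ! i)"
  by (simp add: offset_def)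

lemma offset_n: "offset n = q"
proof -
  have "q = 2 + (\<Sum>j<n. length (map job_code (jobs I) ! j))"
    by (simp add: inst_code_def length_concat_offset[of "map job_code (jobs I)"])
  then show ?thesis by (simp add: offset_def length_job_code)
qed

lemma offset_mono: "i \<le> j \<Longrightarrow> offset i \<le> offset j"
  unfolding offset_def by (intro add_left_mono sum_mono2) auto

lemma offset_le: "i \<le> n \<Longrightarrow> offset i \<le> q"
  using offset_mono offset_n by metis

lemma q_ge_2: "2 \<le> q"
  by (simp add: inst_code_def)

lemma n_less_q: "n < q"
proof -
  have "(\<Sum>j<n. 1) \<le> (\<Sum>j<n. 1 + 5 * length (jobs I ! j))"
    by (intro sum_mono) auto
  then show ?thesis using offset_n by (simp add: offset_def)
qed

lemma inp_job:
  assumes "i < n" "k \<le> 5 * length (jobs I ! i)"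
  shows "inp ! (offset i + k) = job_code (jobs I ! i) ! k" "offset i + k < q"
proof -
  let ?xss = "map job_code (jobs I)"
  have "(\<Sum>j<i. length (?xss ! j)) = (\<Sum>j<i. 1 + 5 * length (jobs I ! j))"
    using assms by (intro sum.cong) (simp_all add: length_job_code)
  then show "inp ! (offset i + k) = job_code (jobs I ! i) ! k"
    using nth_concat_offset[of i ?xss k] assms by (simp add: inst_code_def offset_def length_job_code)
  show "offset i + k < q" using offset_le[of "Suc i"] assms by (simp add: offset_Suc)
qed

lemma inp_header: "i < n \<Longrightarrow> inp ! offset i = length (jobs I ! i)"
  using inp_job[of i 0] by (simp add: job_code_0)

lemma inp_atom:
  assumes "i < n" "a < length (jobs I ! i)" "jobs I ! i ! a = (s, r, p)" "k < 5"
  shows "inp ! (offset i + 1 + 5 * a + k) = [s, num r, den r, num p, den p] ! k"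
    "offset i + 1 + 5 * a + k < q"
  using inp_job[of i "1 + 5 * a + k"] job_code_atom[OF assms(2-)] assms by (simp_all add: add.assoc)

lemma inp_0: "inp ! 0 = B"
  by (simp add: inst_code_def)

definition content :: "nat \<Rightarrow> nat" where
  "content a = (if a = 1 then q else inp ! a)"

lemma content_simps: "content 0 = B" "content (Suc 0) = q"
  by (simp_all add: content_def inp_0)

lemma content_header: "i < n \<Longrightarrow> content (offset i) = length (jobs I ! i)"
  using offset_ge[of i] by (simp add: content_def inp_header)

lemma content_atom:
  assumes "i < n" "a < length (jobs I ! i)" "jobs I ! i ! a = (s, r, p)" "k < 5"
  shows "content (offset i + 1 + 5 * a + k) = [s, num r, den r, num p, den p] ! k"
  using inp_atom(1)[OF assms] offset_ge[of i] by (simp add: content_def)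

lemma layout_content: "a < q \<Longrightarrow> layout inp R h b u a = content a"
  by (auto simp: layout_def content_def)

lemma val_content:
  "val (layout inp R h b u) e < q \<Longrightarrow> val (layout inp R h b u) (Mem e) = content (val (layout inp R h b u) e)"
  by (simp add: layout_content)

text \<open>Multiplying all cells, whatever they encode, makes parsing unnecessary: any multiple of
  all denominators will do. Replacing zeros by 1 keeps the product positive.\<close>

definition common :: nat where
  "common = (\<Prod>a<q. max 1 (content a))"

lemma common_pos: "0 < common"
  by (auto simp: common_def intro!: prod_pos)

lemma content_dvd_common: "a < q \<Longrightarrow> content a \<noteq> 0 \<Longrightarrow> content a dvd common"
  unfolding common_def by (subst (1) max_absorb2[of 1 "content a", symmetric])
    (auto intro!: dvd_prodI)

definition scaled :: "rat \<Rightarrow> nat" where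
  "scaled x = num x * common div den x"

lemma real_scaled: "0 \<le> x \<Longrightarrow> den x dvd common \<Longrightarrow> real (scaled x) = of_rat x * real common"
  by (simp add: scaled_def of_rat_num_den real_of_nat_div)

lemma den_dvd_common:
  assumes "i < n" "(s, r, p) \<in> set (jobs I ! i)"
  shows "den r dvd common" "den p dvd common"
proof -
  obtain a where a: "a < length (jobs I ! i)" "jobs I ! i ! a = (s, r, p)"
    using assms(2) by (auto simp: in_set_conv_nth)
  note c = content_atom[OF assms(1) a] and l = inp_atom(2)[OF assms(1) a]
  show "den r dvd common" using content_dvd_common[OF l[of 2]] c[of 2] den_pos[of r] by simp
  show "den p dvd common" using content_dvd_common[OF l[of 4]] c[of 4] den_pos[of p] by simp
qed

definition atom_value :: "nat \<Rightarrow> (nat \<Rightarrow> nat) \<Rightarrow> nat \<Rightarrow> nat \<times> rat \<times> rat \<Rightarrow> nat" where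
  "atom_value f h t x = (case x of (s, r, p) \<Rightarrow>
     if t + s \<le> B + 1 then scaled p * (scaled r * f + h (t + s)) else 0)"

definition job_value :: "nat \<Rightarrow> (nat \<Rightarrow> nat) \<Rightarrow> nat \<Rightarrow> nat \<Rightarrow> nat" where
  "job_value f h t i = (\<Sum>a<length (jobs I ! i). atom_value f h t (jobs I ! i ! a))"

text \<open>One power of \<open>common\<close> clears the probability, another the reward, and the
  hypothesis gives \<open>h\<close> the same scale. Atoms that overrun the budget contribute 0 on
  both sides, as no prices remain beyond \<open>B\<close>.\<close>

lemma job_value_eq:
  assumes i: "i < n" and h: "\<And>k. t < k \<Longrightarrow> real (h k) = real common * real f * tail_price v k"
  shows "real (job_value f h t i) = real common ^ 2 * real f * E i (payoff (tail_price v) t)"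
proof -
  have "real (atom_value f h t x) = real common ^ 2 * real f * (case x of (s, r, p) \<Rightarrow> of_rat p * payoff (tail_price v) t (s, r))"
    if x: "x \<in> set (jobs I ! i)" for x
  proof -
    obtain s r p where x': "x = (s, r, p)" by (cases x)
    note av = atom_valid[OF i x[unfolded x']] and dv = den_dvd_common[OF i x[unfolded x']]
    show ?thesis
    proof (cases "t + s \<le> B + 1")
      case True
      have "real (h (t + s)) = real common * real f * tail_price v (t + s)" using av by (intro h) simp
      then show ?thesis using True real_scaled[OF av(2) dv(1)] real_scaled[OF av(3) dv(2)]
        by (simp add: x' atom_value_def payoff_def algebra_simps power2_eq_square)
    next
      case False
      then show ?thesis by (simp add: x' atom_value_def payoff_def tail_price_beyond)
    qed
  qed
  then have "real (job_value f h t i) = (\<Sum>a<length (jobs I ! i). real common ^ 2 * real f *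
      (case jobs I ! i ! a of (s, r, p) \<Rightarrow> of_rat p * payoff (tail_price v) t (s, r)))"
    by (simp add: job_value_def)
  also have "\<dots> = real common ^ 2 * real f * E i (payoff (tail_price v) t)"
    by (simp add: E_atoms[OF i] sum_list_sum_nth atLeast0LessThan sum_distrib_left case_prod_unfold)
  finally show ?thesis .
qed

subsection \<open>Extending the prices by one time step\<close>

lemma tail_price_upd: "t < k \<Longrightarrow> tail_price (v(t := x)) k = tail_price v k"
  unfolding tail_price_def by (intro sum.cong) auto

lemma job_price_upd: "t \<le> k \<Longrightarrow> job_price (v(t := x)) (b(t := y)) i k = job_price v b i k"
  unfolding job_price_def by (intro sum.cong) auto

lemma job_price_pred:
  assumes "1 \<le> t" "t \<le> B"
  shows "job_price v b i (t - 1) = of_bool (b t = i) * v t + job_price v b i t"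
proof -
  have "{t - 1<..B} = insert t {t<..B}" using assms by auto
  then show ?thesis by (simp add: job_price_def)
qed

text \<open>Sizes are positive, so a gain at \<open>k\<close> refers only to prices of steps after
  \<open>k\<close>. This makes the backward construction possible: fixing the price at
  \<open>t\<close> disturbs no gain at \<open>t\<close> or later.\<close>

lemma gain_upd:
  assumes "i < n" "t \<le> k"
  shows "gain (v(t := x)) (b(t := y)) i k = gain v b i k"
proof -
  have "E i (payoff (tail_price (v(t := x))) k) = E i (payoff (tail_price v) k)"
  proof (rule E_cong[OF assms(1)])
    fix s r assume "(s, r) \<in> set_pmf (job_pmf I i)"
    then have "t < k + s" using job_support_valid(1)[OF assms(1)] assms(2) by fastforce
    then show "payoff (tail_price (v(t := x))) k (s, r) = payoff (tail_price v) k (s, r)"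
      by (simp add: payoff_def tail_price_upd)
  qed
  then show ?thesis using assms by (simp add: gain_def tail_price_upd job_price_upd)
qed

lemma balanced_extend:
  assumes "balanced v b (t + 1)" "0 \<le> x" "\<And>i. i < n \<Longrightarrow> gain v b i t \<le> x"
    "x = (if y < n then gain v b y t else 0)"
  shows "balanced (v(t := x)) (b(t := y)) t"
  unfolding balanced_def
proof
  fix k assume k: "k \<in> {t..B}"
  let ?v = "v(t := x)" and ?b = "b(t := y)"
  show "0 \<le> ?v k \<and> (\<forall>i<n. gain ?v ?b i k \<le> ?v k) \<and> ?v k = (if ?b k < n then gain ?v ?b (?b k) k else 0)"
  proof (cases "k = t")
    case True
    have "\<forall>i<n. gain ?v ?b i t \<le> x" using assms(3) gain_upd[of _ t t v x b y] by simp
    moreover have "x = (if y < n then gain ?v ?b y t else 0)"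
      using assms(4) gain_upd[of y t t v x b y] by (auto simp del: fun_upd_apply)
    moreover have "?v k = x" "?b k = y" using True by simp_all
    ultimately show ?thesis using assms(2) True by metis
  next
    case False
    then have "k \<in> {t+1..B}" using k by auto
    then have *: "0 \<le> v k \<and> (\<forall>i<n. gain v b i k \<le> v k) \<and> v k = (if b k < n then gain v b (b k) k else 0)"
      using assms(1) unfolding balanced_def by blast
    have "\<forall>i<n. gain ?v ?b i k = gain v b i k" using k by (simp add: gain_upd)
    then show ?thesis using False * by auto
  qed
qed

subsection \<open>Bounds on the numbers that occur\<close>

text \<open>With \<open>S\<close> the input size, \<open>common\<close> has at most about
  \<open>S * S\<close> bits, its largest power \<open>B + 1\<close> contributes
  \<open>S * S * (S + 1)\<close>, the number of steps \<open>S + 1\<close> and a reward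
  \<open>S\<close>. The rest is slack for strict inequalities and small literals.\<close>

definition width :: nat where
  "width = input_size I * input_size I * (input_size I + 1) + 2 * input_size I + 4"

lemma input_size_ge:
  shows "B + q \<le> input_size I" and "a < q \<Longrightarrow> inp ! a < 2 ^ input_size I"
proof -
  have "(\<Sum>v\<leftarrow>xs. 1 + bits v) = length xs + (\<Sum>v\<leftarrow>xs. bits v)" for xs :: "nat list"
    by (induction xs) auto
  then have sum: "(\<Sum>v\<leftarrow>inp. 1 + bits v) = q + (\<Sum>v\<leftarrow>inp. bits v)" .
  then show "B + q \<le> input_size I" by (simp add: input_size_def)
  assume "a < q"
  then have "bits (inp ! a) \<in> set (map bits inp)" by simp
  then have "bits (inp ! a) \<le> (\<Sum>v\<leftarrow>inp. bits v)" by (rule member_le_sum_list) simp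
  then have "bits (inp ! a) \<le> input_size I"
    using sum by (simp add: input_size_def)
  then show "inp ! a < 2 ^ input_size I" by (simp add: bits_le_iff)
qed

lemma content_less:
  assumes "a < q" shows "content a < 2 ^ input_size I"
proof (cases "a = 1")
  case True
  have "q \<le> input_size I" using input_size_ge(1) by simp
  also have "\<dots> < 2 ^ input_size I" by simp
  finally show ?thesis using True by (simp add: content_def)
qed (use assms input_size_ge(2) in \<open>simp add: content_def\<close>)

text \<open>Stated for subsets because the intermediate products of the scaling loop must fit into
  memory as well.\<close>

lemma partial_common_le:
  assumes "A \<subseteq> {..<q}"
  shows "(\<Prod>a\<in>A. max 1 (content a)) \<le> 2 ^ (input_size I * input_size I)"
proof -
  have "(\<Prod>a\<in>A. max 1 (content a)) \<le> (\<Prod>a\<in>A. 2 ^ input_size I)"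
    using assms content_less by (intro prod_mono) (auto intro: less_imp_le)
  also have "\<dots> = 2 ^ (input_size I * card A)"
    by (simp add: power_mult)
  also have "\<dots> \<le> 2 ^ (input_size I * input_size I)"
    using card_mono[OF _ assms] input_size_ge(1) by (intro power_increasing mult_le_mono2) auto
  finally show ?thesis .
qed

lemma common_le: "common \<le> 2 ^ (input_size I * input_size I)"
  unfolding common_def by (rule partial_common_le) simp

lemma less_width1: "(x :: nat) \<le> 2 ^ (input_size I * input_size I) \<Longrightarrow> x < 2 ^ width"
  by (erule order.strict_trans1, rule power_strict_increasing) (auto simp: width_def)

lemma less_width2: "x \<le> q + B + 2 \<Longrightarrow> x < 2 ^ width"
proof -
  assume "x \<le> q + B + 2"
  then have "x \<le> input_size I + 2" using input_size_ge(1) by simp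
  also have "\<dots> < 2 ^ (input_size I + 2)" by (rule less_exp)
  also have "\<dots> \<le> 2 ^ width" by (rule power_increasing) (auto simp: width_def)
  finally show ?thesis .
qed

lemma less_width3: "x \<le> common ^ (B + 1) * ((B + 1) * 2 ^ input_size I) \<Longrightarrow> x < 2 ^ width"
proof -
  let ?S = "input_size I"
  assume "x \<le> common ^ (B + 1) * ((B + 1) * 2 ^ ?S)"
  also have "\<dots> \<le> (2 ^ (?S * ?S)) ^ (?S + 1) * (2 ^ (?S + 1) * 2 ^ ?S)"
  proof (intro mult_le_mono order_refl)
    have "common ^ (B + 1) \<le> common ^ (?S + 1)"
      using common_pos input_size_ge(1) by (intro power_increasing) auto
    also have "\<dots> \<le> (2 ^ (?S * ?S)) ^ (?S + 1)" by (intro power_mono common_le) simp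
    finally show "common ^ (B + 1) \<le> (2 ^ (?S * ?S)) ^ (?S + 1)" .
    have "B + 1 \<le> ?S + 1" using input_size_ge(1) by simp
    also have "\<dots> \<le> 2 ^ (?S + 1)" by (rule less_imp_le[OF less_exp])
    finally show "B + 1 \<le> 2 ^ (?S + 1)" .
  qed
  also have "\<dots> = 2 ^ (?S * ?S * (?S + 1) + (?S + 1 + ?S))"
    unfolding power_add power_mult ..
  also have "\<dots> < 2 ^ width" by (rule power_strict_increasing) (auto simp: width_def)
  finally show ?thesis .
qed

lemma less_width4: "(x :: nat) < 2 ^ input_size I \<Longrightarrow> x < 2 ^ width"
  by (erule order.strict_trans2, rule power_increasing) (auto simp: width_def)

lemma reward_less:
  assumes "i < n" "(s, r) \<in> set_pmf (job_pmf I i)"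
  shows "num r < 2 ^ input_size I" "den r < 2 ^ input_size I" "of_rat r \<le> (2 ^ input_size I :: real)"
proof -
  obtain p where "(s, r, p) \<in> set (jobs I ! i)" using job_support[OF assms] by blast
  then obtain a where a: "a < length (jobs I ! i)" "jobs I ! i ! a = (s, r, p)"
    by (auto simp: in_set_conv_nth)
  note c = content_atom[OF assms(1) a] and l = inp_atom(2)[OF assms(1) a]
  show nr: "num r < 2 ^ input_size I" "den r < 2 ^ input_size I"
    using content_less[OF l[of 1]] content_less[OF l[of 2]] c[of 1] c[of 2] by simp_all
  have "of_rat r = real (num r) / real (den r)"
    using job_support_valid(2)[OF assms] by (rule of_rat_num_den)
  also have "\<dots> \<le> real (num r) / 1" using den_pos[of r] by (intro divide_left_mono) auto
  also have "\<dots> \<le> 2 ^ input_size I" using nr(1) by (simp add: less_imp_le)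
  finally show "of_rat r \<le> (2 ^ input_size I :: real)" .
qed

lemma tail_price_antimono': "balanced v b t0 \<Longrightarrow> t0 \<le> t \<Longrightarrow> t \<le> t' \<Longrightarrow> tail_price v t' \<le> tail_price v t"
  unfolding tail_price_def by (intro sum_mono2) (auto simp: balanced_nonneg)

lemma payoff_le:
  assumes bal: "balanced v b (t + 1)" and i: "i < n"
  shows "E i (payoff (tail_price v) t) \<le> 2 ^ input_size I + tail_price v (t + 1)"
proof -
  have "E i (payoff (tail_price v) t) \<le> E i (\<lambda>z. 2 ^ input_size I + tail_price v (t + 1))"
  proof (rule E_mono[OF i])
    fix s r assume sr: "(s, r) \<in> set_pmf (job_pmf I i)"
    then have "tail_price v (t + s) \<le> tail_price v (t + 1)"
      using job_support_valid[OF i sr] by (intro tail_price_antimono'[OF bal]) auto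
    moreover have "(if t + s \<le> B + 1 then of_rat r else 0) \<le> (2 ^ input_size I :: real)"
      using reward_less(3)[OF i sr] by simp
    ultimately show "payoff (tail_price v) t (s, r) \<le> 2 ^ input_size I + tail_price v (t + 1)"
      unfolding payoff_def fst_conv snd_conv by (rule add_mono[rotated])
  qed
  then show ?thesis by simp
qed

lemma job_price_bounds:
  assumes "balanced v b (t + 1)"
  shows "0 \<le> job_price v b i t" "job_price v b i t \<le> tail_price v (t + 1)"
proof -
  have "tail_price v (t + 1) = (\<Sum>\<tau>\<in>{t<..B}. v \<tau>)"
    unfolding tail_price_def by (intro sum.cong) auto
  moreover have nn: "0 \<le> v \<tau>" if "\<tau> \<in> {t<..B}" for \<tau>
    using balanced_nonneg[OF assms, of \<tau>] that by simp
  ultimately show "job_price v b i t \<le> tail_price v (t + 1)"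
    unfolding job_price_def by (simp only:) (intro sum_mono, simp)
  show "0 \<le> job_price v b i t"
    unfolding job_price_def using nn by (intro sum_nonneg) simp
qed

text \<open>The tail after completion is at most the tail from \<open>t + 1\<close>, which the gain
  subtracts, so at most the reward is left. Without such a bound prices could grow from round to
  round.\<close>

lemma gain_le:
  assumes "balanced v b (t + 1)" "i < n"
  shows "gain v b i t \<le> 2 ^ input_size I"
  using payoff_le[OF assms] job_price_bounds(1)[OF assms(1), of i] by (simp add: gain_def)

lemma balanced_later: "balanced v b t0 \<Longrightarrow> t0 \<le> t \<Longrightarrow> balanced v b t"
  unfolding balanced_def by (intro ballI, erule bspec) simp

lemma tail_price_le:
  assumes bal: "balanced v b t0" and t: "t0 \<le> t"
  shows "tail_price v t \<le> real (B + 1 - t) * 2 ^ input_size I"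
proof -
  have "v \<tau> \<le> 2 ^ input_size I" if \<tau>: "\<tau> \<in> {t..B}" for \<tau>
  proof -
    have "\<tau> \<in> {t0..B}" using \<tau> t by auto
    then have "v \<tau> = (if b \<tau> < n then gain v b (b \<tau>) \<tau> else 0)"
      using bal unfolding balanced_def by blast
    moreover have "balanced v b (\<tau> + 1)" using \<tau> t by (intro balanced_later[OF bal]) auto
    ultimately show ?thesis using gain_le[of v b \<tau> "b \<tau>"] by (auto split: if_splits)
  qed
  then have "tail_price v t \<le> (\<Sum>\<tau>\<in>{t..B}. 2 ^ input_size I)"
    unfolding tail_price_def by (intro sum_mono)
  then show ?thesis by simp
qed

end

subsection \<open>Execution of the planning phase\<close>

declare val.simps(2) [simp del]

lemma num_steps_code [simp]:
  "num_steps scale_step = 5" "num_steps atom_step = 7" "num_steps job_start = 5" "num_steps job_finish = 7"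
  "num_steps rescale_step = 5" "num_steps time_start = 7" "num_steps time_finish = 9"
  by (simp_all add: scale_step_def atom_step_def job_start_def job_finish_def rescale_step_def time_start_def
    time_finish_def decr_def skip_def)

lemma expr_size_reg: "k < 16 \<Longrightarrow> expr_size (reg_addr k) \<le> 199"
  using expr_size_reg_addr[of k] by linarith

context knapsack
begin

declare q_ge_2 [simp]

lemma val_header_cells [simp]:
  "val (layout inp R h b u) (Mem (Lit 0)) = B"
  "val (layout inp R h b u) (Mem (Lit (Suc 0))) = q"
  by (simp_all add: val.simps(2) inp_0)

definition small :: "(nat \<Rightarrow> nat) \<Rightarrow> bool" where
  "small f \<longleftrightarrow> (\<forall>k. f k < 2 ^ width)"

lemma smallD: "small f \<Longrightarrow> f k < 2 ^ width"
  by (simp add: small_def)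

lemma small_upd: "small f \<Longrightarrow> v < 2 ^ width \<Longrightarrow> small (f(k := v))"
  by (simp add: small_def)

lemma bounded_state:
  "small R \<Longrightarrow> small h \<Longrightarrow> small b \<Longrightarrow> small u \<Longrightarrow> bounded_mem width (layout inp R h b u)"
  by (rule bounded_layout) (auto simp: smallD less_width2 less_width4 input_size_ge(2))

lemma width_ge: "x < 16 \<Longrightarrow> x < (2 :: nat) ^ width"
proof -
  assume "x < 16"
  then have "x < 2 ^ 4" by simp
  also have "(2 :: nat) ^ 4 \<le> 2 ^ width" by (rule power_increasing) (auto simp: width_def)
  finally show ?thesis .
qed

lemma exec_block:
  assumes "straight c" "small R" "small h" "small b" "small u" "fits width c (layout inp R h b u)"
    "result c (layout inp R h b u) = m'"
  shows "exec width c (layout inp R h b u) m' (num_steps c)"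
  using exec_straight[OF assms(1) bounded_state[OF assms(2-5)] assms(6)] assms(7) by simp

text \<open>Cell 1 itself is the moving pointer and runs through the values \<open>offset i\<close>.
  Behind the input the memory is 0, so the pointer stops at \<open>offset n = q\<close>, exactly the
  content of cell 1 that \<open>layout\<close> prescribes.\<close>

lemma exec_locate_end:
  "exec width locate_end (store 0 inp (\<lambda>_. 0)) (layout inp (\<lambda>_. 0) (\<lambda>_. 0) (\<lambda>_. 0) (\<lambda>_. 0)) (2 * n + 3)"
proof -
  let ?m = "store 0 inp (\<lambda>_. 0)"
  let ?M = "\<lambda>i. ?m(1 := offset i)"
  have m: "?m a = (if a < q then inp ! a else 0)" for a
    by (simp add: store_def)
  have bnd: "bounded_mem width ?m"
    unfolding bounded_mem_def m using less_width4[OF input_size_ge(2)] by simp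
  have off: "offset i < 2 ^ width" if "i \<le> n" for i
    using offset_le[OF that] by (intro less_width2) simp
  have bndM: "bounded_mem width (?M i)" if "i \<le> n" for i
    using bnd off[OF that] by (simp add: bounded_mem_def)
  have val: "val (?M i) (Mem (Lit 1)) = offset i" "val (?M i) (Mem (Mem (Lit 1))) = ?m (offset i)" for i
    using offset_ge[of i] by (simp_all add: val.simps(2))
  have first: "exec width (Assign (Lit 1) (Lit 2)) ?m (?M 0) 1"
    using exec_straight[of "Assign (Lit 1) (Lit 2)" width ?m] bnd width_ge[of 2]
    by (simp add: bits_numerals)
  let ?body = "Assign (Lit 1) (Add (Add input_end (Lit 1)) (Mul (Lit 5) (Mem input_end)))"
  have "\<exists>m'. exec width (Loop (Mem (Mem (Lit 1))) ?body) (?M 0) m' (n * (1 + 1) + 1) \<and> m' = ?M n"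
  proof (rule exec_Loop[where Inv = "\<lambda>i m. m = ?M i"])
    fix i m assume i: "i < n" and m': "m = ?M i"
    have len: "?m (offset i) = length (jobs I ! i)"
      using inp_header[OF i] inp_job(2)[OF i, of 0] m by simp
    have "exec width ?body (?M i) (result ?body (?M i)) (num_steps ?body)"
      using i off[of "Suc i"] exec_straight[of ?body width "?M i"] bndM[of i]
      by (simp only: straight.simps fits.simps val.simps(1,3,5) val len offset_Suc)
        (simp add: bits_numerals)
    moreover have "result ?body (?M i) = ?M (Suc i)"
      unfolding result.simps val.simps(1,3,5) val len offset_Suc by (simp add: fun_eq_iff)
    ultimately have "exec width ?body m (?M (Suc i)) 1" by (simp add: m')
    then show "val m (Mem (Mem (Lit 1))) \<noteq> 0 \<and> (\<exists>m'. exec width ?body m m' 1 \<and> m' = ?M (Suc i))"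
      unfolding m' val len using jobs_nonempty[OF i] by simp
  next
    fix m assume m': "m = ?M n"
    show "val m (Mem (Mem (Lit 1))) = 0" unfolding m' val(2) by (simp add: m offset_n)
  qed (use bndM in \<open>auto simp: bits_numerals\<close>)
  then have "exec width locate_end ?m (?M n) (1 + 1 + (n * (1 + 1) + 1))"
    unfolding locate_end_def using exec_Seq[OF first] by blast
  moreover have "?M n = layout inp (\<lambda>_. 0) (\<lambda>_. 0) (\<lambda>_. 0) (\<lambda>_. 0)"
    by (auto simp: fun_eq_iff m layout_def offset_n Let_def)
  ultimately have "exec width locate_end ?m (layout inp (\<lambda>_. 0) (\<lambda>_. 0) (\<lambda>_. 0) (\<lambda>_. 0)) (1 + 1 + (n * (1 + 1) + 1))"
    by (simp only:)
  then show ?thesis by (rule exec_mono) simp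
qed

lemma exec_find_scale:
  assumes "small R0" "small h" "small b" "small u"
  shows "\<exists>R. exec width find_scale (layout inp R0 h b u) (layout inp R h b u) (6 * q + 5) \<and> small R \<and> R 0 = common"
proof -
  let ?R1 = "R0(0 := 1)" let ?R2 = "?R1(9 := q)"
  have q: "q < 2 ^ width" by (rule less_width2) simp
  have 1: "exec width (set_reg 0 (Lit 1)) (layout inp R0 h b u) (layout inp ?R1 h b u) 1"
    using exec_block[of "set_reg 0 (Lit 1)" R0 h b u] assms width_ge[of 1] by (simp add: bits_numerals)
  have s1: "small ?R1" using assms(1) width_ge[of 1] by (intro small_upd) auto
  have 2: "exec width (set_reg 9 input_end) (layout inp ?R1 h b u) (layout inp ?R2 h b u) 1"
    using exec_block[of "set_reg 9 input_end" ?R1 h b u] assms s1 q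
    by (simp add: bits_numerals val_content content_simps)
  have s2: "small ?R2" using s1 q by (rule small_upd)
  let ?Inv = "\<lambda>a m. \<exists>R. m = layout inp R h b u \<and> small R \<and> R 9 = q - a \<and>
    R 0 = (\<Prod>x\<in>{q - a..<q}. max 1 (content x))"
  have "\<exists>m'. exec width (Loop idx scale_step) (layout inp ?R2 h b u) m' (q * (5 + 1) + 1) \<and> ?Inv q m'"
  proof (rule exec_Loop[where Inv = ?Inv])
    fix a m assume a: "a < q" and "?Inv a m"
    then obtain R where R: "m = layout inp R h b u" "small R" "R 9 = q - a"
      "R 0 = (\<Prod>x\<in>{q - a..<q}. max 1 (content x))" by blast
    define x where "x = q - Suc a"
    have x: "R 9 - 1 = x" "x < q" using a R(3) by (auto simp: x_def)
    have ins: "{q - Suc a..<q} = insert x {q - a..<q}" "x \<notin> {q - a..<q}" using a by (auto simp: x_def)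
    have new: "(\<Prod>x\<in>{q - Suc a..<q}. max 1 (content x)) = max 1 (content x) * R 0"
      unfolding ins(1) R(4) using ins(2) by simp
    have "max 1 (content x) * R 0 \<le> 2 ^ (input_size I * input_size I)"
      unfolding new[symmetric] by (rule partial_common_le) auto
    then have lt: "max 1 (content x) * R 0 < 2 ^ width" by (rule less_width1)
    have "R 0 * content x \<le> max 1 (content x) * R 0" by (simp add: mult.commute[of "R 0"])
    then have lt: "R 0 * content x < 2 ^ width" using lt by (rule order.strict_trans1)
    have xw: "x < 2 ^ width" using x q by simp
    let ?R' = "if content x = 0 then R(9 := x, 15 := 0) else R(9 := x, 0 := R 0 * content x)"
    have "exec width scale_step m (layout inp ?R' h b u) (num_steps scale_step)"
      unfolding R(1)
      by (rule exec_block[OF straight_code(1)]) (use assms R(2) x xw lt in \<open>simp_all add: scale_step_def decr_def skip_def val_content mult.commute\<close>)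
    moreover have "small ?R'" using R(2) xw lt by (auto intro!: small_upd simp: mult.commute)
    moreover have "?R' 9 = q - Suc a" by (simp add: x_def)
    moreover have "?R' 0 = (\<Prod>x\<in>{q - Suc a..<q}. max 1 (content x))" unfolding new by (simp add: mult.commute)
    ultimately show "val m idx \<noteq> 0 \<and> (\<exists>m'. exec width scale_step m m' 5 \<and> ?Inv (Suc a) m')"
      using a R by (auto simp del: One_nat_def)
  qed (use assms s2 in \<open>auto intro: bounded_state simp: expr_size_reg\<close>)
  then obtain R where R: "exec width (Loop idx scale_step) (layout inp ?R2 h b u) (layout inp R h b u) (q * (5 + 1) + 1)"
    "small R" "R 0 = (\<Prod>x\<in>{q - q..<q}. max 1 (content x))" by blast
  have "exec width find_scale (layout inp R0 h b u) (layout inp R h b u) (1 + 1 + (1 + 1 + (q * (5 + 1) + 1)))"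
    unfolding find_scale_def by (intro exec_Seq[OF 1] exec_Seq[OF 2] R(1))
  then have "exec width find_scale (layout inp R0 h b u) (layout inp R h b u) (6 * q + 5)"
    by (rule exec_mono) simp
  moreover have "R 0 = common" using R(3) by (simp add: common_def atLeast0LessThan)
  ultimately show ?thesis using R(2) by blast
qed

lemma exec_atoms:
  assumes i: "i < n" and small: "small R0" "small h" "small b" "small u"
    and R0: "R0 3 = offset i + 1" "R0 4 = length (jobs I ! i)" "R0 6 = 0" "R0 0 = common" "R0 1 = f" "R0 2 = t"
    and jv: "job_value f h t i < 2 ^ width"
  shows "\<exists>R. exec width (Loop atoms_left atom_step) (layout inp R0 h b u) (layout inp R h b u)
      (8 * length (jobs I ! i) + 1) \<and>
    small R \<and> R 6 = job_value f h t i \<and> R 3 = offset (Suc i) \<and> (\<forall>k. k \<notin> {3, 4, 6, 15} \<longrightarrow> R k = R0 k)"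
proof -
  let ?len = "length (jobs I ! i)"
  let ?Inv = "\<lambda>a m. \<exists>R. m = layout inp R h b u \<and> small R \<and> R 3 = offset i + 1 + 5 * a \<and> R 4 = ?len - a \<and>
    R 6 = (\<Sum>a<a. atom_value f h t (jobs I ! i ! a)) \<and> (\<forall>k. k \<notin> {3, 4, 6, 15} \<longrightarrow> R k = R0 k)"
  have "\<exists>m'. exec width (Loop atoms_left atom_step) (layout inp R0 h b u) m' (?len * (7 + 1) + 1) \<and> ?Inv ?len m'"
  proof (rule exec_Loop[where Inv = ?Inv])
    fix a m assume a: "a < ?len" and "?Inv a m"
    then obtain R where R: "m = layout inp R h b u" "small R" "R 3 = offset i + 1 + 5 * a" "R 4 = ?len - a"
      "R 6 = (\<Sum>a<a. atom_value f h t (jobs I ! i ! a))" "\<forall>k. k \<notin> {3, 4, 6, 15} \<longrightarrow> R k = R0 k" by blast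
    obtain s r p where x: "jobs I ! i ! a = (s, r, p)" by (cases "jobs I ! i ! a")
    define ad where "ad = R 3"
    note c = content_atom[OF i a x] inp_atom(2)[OF i a x]
    have ad: "content ad = s" "content (ad + 1) = num r" "content (ad + 2) = den r" "content (ad + 3) = num p"
      "content (ad + 4) = den p" "ad + 4 < q"
      using c(1)[of 0] c(1)[of 1] c(1)[of 2] c(1)[of 3] c(1)[of 4] c(2)[of 4] by (simp_all add: ad_def R(3))
    have regs: "R 0 = common" "R 1 = f" "R 2 = t" "R 3 = ad" using R(6) R0 by (simp_all add: ad_def)
    \<comment> \<open>A partial sum of natural numbers is at most the full sum, which is known to
      fit.\<close>
    have "(\<Sum>a<Suc a. atom_value f h t (jobs I ! i ! a)) \<le> job_value f h t i"
      unfolding job_value_def using a by (intro sum_mono2) auto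
    then have lt: "R 6 + atom_value f h t (s, r, p) < 2 ^ width"
      using jv unfolding R(5) by (simp add: x)
    then have lt': "R 6 + scaled p * (scaled r * f + h (t + s)) < 2 ^ width" if "t + s \<le> B + 1"
      using that by (simp add: atom_value_def)
    have adw: "ad + 5 < 2 ^ width" using ad(6) by (intro less_width2) simp
    have c4: "R 4 - 1 < 2 ^ width" using smallD[OF R(2), of 4] by simp
    let ?R' = "(if t + s \<le> B + 1 then R(6 := R 6 + atom_value f h t (s, r, p)) else R(15 := 0))(3 := ad + 5, 4 := R 4 - 1)"
    have cond: "t + s - (B + 1) = 0 \<longleftrightarrow> t + s \<le> B + 1" by auto
    have "exec width atom_step m (layout inp ?R' h b u) (num_steps atom_step)"
      unfolding R(1)
      by (rule exec_block[OF straight_code(2)]) (use small(2-) R(2) ad regs lt' adw c4 in \<open>simp_all add: atom_step_def decr_def skip_def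
          val_content content_simps atom_term_def scaled_prob_def scaled_reward_def atom_value_def scaled_def[symmetric]\<close>)
    moreover have "small ?R'" using R(2) lt adw c4 by (auto intro!: small_upd)
    moreover have "?R' 3 = offset i + 1 + 5 * Suc a" using R(3) by (simp add: ad_def)
    moreover have "?R' 4 = ?len - Suc a" using R(4) by simp
    moreover have "?R' 6 = (\<Sum>a<Suc a. atom_value f h t (jobs I ! i ! a))"
      using R(5) by (simp add: x) (simp add: atom_value_def)
    moreover have "\<forall>k. k \<notin> {3, 4, 6, 15} \<longrightarrow> ?R' k = R0 k" using R(6) by simp
    ultimately show "val m atoms_left \<noteq> 0 \<and> (\<exists>m'. exec width atom_step m m' 7 \<and> ?Inv (Suc a) m')"
      using a R(1,4) by (simp only: num_steps_code) (intro conjI exI, simp, assumption, rule refl, assumption+)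
  next
    show "?Inv 0 (layout inp R0 h b u)" using R0 small(1) by (intro exI[of _ R0]) simp
  qed (use small in \<open>auto intro: bounded_state simp: expr_size_reg\<close>)
  then obtain R where "exec width (Loop atoms_left atom_step) (layout inp R0 h b u) (layout inp R h b u) (?len * (7 + 1) + 1)"
    "small R" "R 3 = offset i + 1 + 5 * ?len"
    "R 6 = (\<Sum>a<?len. atom_value f h t (jobs I ! i ! a))" "\<forall>k. k \<notin> {3, 4, 6, 15} \<longrightarrow> R k = R0 k"
    by blast
  then show ?thesis
    by (intro exI[of _ R]) (simp add: job_value_def offset_Suc mult.commute)
qed

definition job_gain :: "nat \<Rightarrow> (nat \<Rightarrow> nat) \<Rightarrow> (nat \<Rightarrow> nat) \<Rightarrow> nat \<Rightarrow> nat \<Rightarrow> nat" where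
  "job_gain f h u t i = job_value f h t i - common * (h (t + 1) + u i)"

text \<open>The index \<open>q\<close> stands for the absence of a job with positive gain;
  \<open>n < q\<close> separates it from all jobs.\<close>

definition best_among :: "(nat \<Rightarrow> nat) \<Rightarrow> nat \<Rightarrow> nat \<Rightarrow> nat \<Rightarrow> bool" where
  "best_among g i x y \<longleftrightarrow> (\<forall>j<i. g j \<le> x) \<and> (y = q \<and> x = 0 \<or> y < i \<and> x = g y \<and> 0 < x)"

lemma best_among_Suc:
  "best_among g i x y \<Longrightarrow> best_among g (Suc i) (if x < g i then g i else x) (if x < g i then i else y)"
  by (auto simp: best_among_def less_Suc_eq)

lemma exec_job:
  assumes i: "i < n" and small: "small R0" "small h" "small b" "small u"
    and R0: "R0 0 = common" "R0 1 = f" "R0 2 = t" "R0 3 = offset i" "R0 5 = i"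
      "best_among (job_gain f h u t) i (R0 7) (R0 8)"
    and jv: "job_value f h t i < 2 ^ width"
  shows "\<exists>R. exec width job_step (layout inp R0 h b u) (layout inp R h b u) (8 * q + 15) \<and> small R \<and>
    R 0 = common \<and> R 1 = f \<and> R 2 = t \<and> R 3 = offset (Suc i) \<and> R 5 = Suc i \<and>
    best_among (job_gain f h u t) (Suc i) (R 7) (R 8)"
proof -
  let ?len = "length (jobs I ! i)" let ?g = "job_gain f h u t"
  have off: "offset i < q" "offset i + 1 + 5 * ?len \<le> q" using inp_job(2)[OF i, of 0] offset_le[of "Suc i"] i by (auto simp: offset_Suc)
  let ?R1 = "R0(4 := ?len, 3 := offset i + 1, 6 := 0)"
  have lenw: "?len < 2 ^ width" "offset i + 1 < 2 ^ width" using off by (auto intro!: less_width2)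
  have s1: "small ?R1" using small(1) lenw width_ge[of 0] by (auto intro!: small_upd)
  have 1: "exec width job_start (layout inp R0 h b u) (layout inp ?R1 h b u) 5"
    by (rule exec_block[OF straight_code(3) small, unfolded num_steps_code])
      (use lenw off(1) R0 i in \<open>simp_all add: job_start_def val_content content_header\<close>)
  obtain R2 where 2: "exec width (Loop atoms_left atom_step) (layout inp ?R1 h b u) (layout inp R2 h b u) (8 * ?len + 1)"
    and R2: "small R2" "R2 6 = job_value f h t i" "R2 3 = offset (Suc i)" "\<forall>k. k \<notin> {3, 4, 6, 15} \<longrightarrow> R2 k = ?R1 k"
    using exec_atoms[OF i s1 small(2-) _ _ _ _ _ _ jv] R0 by auto
  have regs: "R2 0 = common" "R2 1 = f" "R2 2 = t" "R2 5 = i" "R2 7 = R0 7" "R2 8 = R0 8"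
    using R2(4) R0 by simp_all
  have gw: "?g i < 2 ^ width" using jv by (auto simp: job_gain_def)
  have iw: "i + 1 < 2 ^ width" using i n_less_q by (intro less_width2) simp
  then have iw': "i < 2 ^ width" by simp
  let ?R3 = "(if R2 7 < ?g i then R2(8 := i, 7 := ?g i) else R2(15 := 0))(5 := i + 1)"
  have 3: "exec width job_finish (layout inp R2 h b u) (layout inp ?R3 h b u) 7"
    by (rule exec_block[OF straight_code(4) R2(1) small(2-), unfolded num_steps_code])
      (use gw iw iw' regs R2(2) in \<open>auto simp: job_finish_def scaled_gain_def skip_def job_gain_def less_diff_conv\<close>)
  have s3: "small ?R3" using R2(1) gw iw iw' by (auto intro!: small_upd)
  have "exec width job_step (layout inp R0 h b u) (layout inp ?R3 h b u) (1 + 5 + (1 + (8 * ?len + 1) + 7))"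
    unfolding job_step_def by (intro exec_Seq[OF 1] exec_Seq[OF 2] 3)
  then have "exec width job_step (layout inp R0 h b u) (layout inp ?R3 h b u) (8 * q + 15)"
    by (rule exec_mono) (use off in simp)
  moreover have "best_among ?g (Suc i) (?R3 7) (?R3 8)"
    using best_among_Suc[OF R0(6)] regs by auto
  ultimately show ?thesis
    using s3 regs R2(3) by (intro exI[of _ ?R3]) simp
qed

lemma exec_jobs:
  assumes small: "small R0" "small h" "small b" "small u"
    and R0: "R0 0 = common" "R0 1 = f" "R0 2 = t" "R0 3 = 2" "R0 5 = 0" "R0 7 = 0" "R0 8 = q"
    and jv: "\<And>i. i < n \<Longrightarrow> job_value f h t i < 2 ^ width"
  shows "\<exists>R. exec width (Loop (Sub input_end ptr) job_step) (layout inp R0 h b u) (layout inp R h b u)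
      (n * (8 * q + 16) + 1) \<and> small R \<and>
    R 0 = common \<and> R 1 = f \<and> R 2 = t \<and> best_among (job_gain f h u t) n (R 7) (R 8)"
proof -
  let ?g = "job_gain f h u t"
  let ?Inv = "\<lambda>i m. \<exists>R. m = layout inp R h b u \<and> small R \<and> R 0 = common \<and> R 1 = f \<and> R 2 = t \<and>
    R 3 = offset i \<and> R 5 = i \<and> best_among ?g i (R 7) (R 8)"
  have "\<exists>m'. exec width (Loop (Sub input_end ptr) job_step) (layout inp R0 h b u) m' (n * ((8 * q + 15) + 1) + 1) \<and> ?Inv n m'"
  proof (rule exec_Loop[where Inv = ?Inv])
    fix i m assume i: "i < n" and "?Inv i m"
    then obtain R where m: "m = layout inp R h b u" and R: "small R" "R 0 = common" "R 1 = f" "R 2 = t"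
      "R 3 = offset i" "R 5 = i" "best_among ?g i (R 7) (R 8)" by blast
    have "offset i < q" using inp_job(2)[OF i, of 0] by simp
    then have "val m (Sub input_end ptr) \<noteq> 0" using R(5) by (simp add: m)
    moreover have "\<exists>m'. exec width job_step m m' (8 * q + 15) \<and> ?Inv (Suc i) m'"
      using exec_job[OF i R(1) small(2-) R(2-) jv[OF i]] unfolding m by blast
    ultimately show "val m (Sub input_end ptr) \<noteq> 0 \<and> (\<exists>m'. exec width job_step m m' (8 * q + 15) \<and> ?Inv (Suc i) m')" ..
  next
    show "?Inv 0 (layout inp R0 h b u)"
      using R0 small(1) by (intro exI[of _ R0]) (simp add: best_among_def)
  next
    show "expr_size (Sub input_end ptr) \<le> 200" by (simp add: reg_addr_def bits_numerals)
  qed (use small in \<open>auto intro: bounded_state simp: offset_n\<close>)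
  then show ?thesis by (simp only: add.assoc) auto
qed

lemma exec_rescale:
  assumes small: "small R0" "small h" "small b" "small u" and R0: "R0 0 = common"
    and scaled: "\<And>k. h k * common < 2 ^ width" "\<And>k. u k * common < 2 ^ width"
    and zero: "\<And>k. q + B + 2 \<le> k \<Longrightarrow> h k = 0" "\<And>k. q + B + 2 \<le> k \<Longrightarrow> u k = 0"
  shows "\<exists>R. exec width rescale (layout inp R0 h b u) (layout inp R (\<lambda>k. h k * common) b (\<lambda>k. u k * common))
      (6 * (q + B + 2) + 3) \<and> small R \<and> (\<forall>k. k \<noteq> 9 \<longrightarrow> R k = R0 k)"
proof -
  let ?N = "q + B + 2"
  have N: "?N < 2 ^ width" by (rule less_width2) simp
  let ?R1 = "R0(9 := ?N)"
  have s1: "small ?R1" using small(1) N by (rule small_upd)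
  have 1: "exec width (set_reg 9 (Add input_end (Add time_budget (Lit 2)))) (layout inp R0 h b u) (layout inp ?R1 h b u) 1"
    using exec_block[of "set_reg 9 (Add input_end (Add time_budget (Lit 2)))" R0 h b u] small N
    by (simp add: bits_numerals add.assoc)
  let ?s = "\<lambda>a f k. if ?N - a \<le> k then f k * common else f k :: nat"
  let ?Inv = "\<lambda>a m. \<exists>R. m = layout inp R (?s a h) b (?s a u) \<and> small R \<and> R 9 = ?N - a \<and> (\<forall>k. k \<noteq> 9 \<longrightarrow> R k = R0 k)"
  have small_s: "small (?s a h)" "small (?s a u)" for a
    using small scaled by (simp_all add: small_def)
  have "\<exists>m'. exec width (Loop idx rescale_step) (layout inp ?R1 h b u) m' (?N * (5 + 1) + 1) \<and> ?Inv ?N m'"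
  proof (rule exec_Loop[where Inv = ?Inv])
    fix a m assume a: "a < ?N" and "?Inv a m"
    then obtain R where m: "m = layout inp R (?s a h) b (?s a u)" and R: "small R" "R 9 = ?N - a"
      "\<forall>k. k \<noteq> 9 \<longrightarrow> R k = R0 k" by blast
    define x where "x = ?N - Suc a"
    have x: "R 9 - 1 = x" "\<not> ?N - a \<le> x" "x < 2 ^ width" using a R(2) N by (auto simp: x_def)
    have upd: "(?s a f)(x := f x * common) = ?s (Suc a) f" for f
      using a by (auto simp: x_def fun_eq_iff)
    let ?R' = "R(9 := x)"
    have r0: "R 0 = common" using R(3) R0 by simp
    have "result rescale_step m = layout inp ?R' ((?s a h)(x := h x * common)) b ((?s a u)(x := u x * common))"
      using x r0 by (simp add: m rescale_step_def decr_def)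
    moreover have "fits width rescale_step m"
      using x r0 scaled by (simp add: m rescale_step_def decr_def)
    ultimately have "exec width rescale_step m (layout inp ?R' (?s (Suc a) h) b (?s (Suc a) u)) 5"
      using exec_block[OF straight_code(5) R(1) small_s(1)[of a] small(3) small_s(2)[of a]]
      unfolding m upd by simp
    moreover have "small ?R'" using R(1) x(3) by (rule small_upd)
    moreover have "?R' 9 = ?N - Suc a" "\<forall>k. k \<noteq> 9 \<longrightarrow> ?R' k = R0 k" using R(3) by (simp_all add: x_def)
    ultimately have "\<exists>m'. exec width rescale_step m m' 5 \<and> ?Inv (Suc a) m'" by blast
    moreover have "val m idx \<noteq> 0" using a R(2) by (simp add: m)
    ultimately show "val m idx \<noteq> 0 \<and> (\<exists>m'. exec width rescale_step m m' 5 \<and> ?Inv (Suc a) m')" by blast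
  next
    \<comment> \<open>Entries from \<open>?N\<close> on are 0 and thus count as rescaled from the
      outset.\<close>
    have "?s 0 h = h" "?s 0 u = u" using zero by (auto simp: fun_eq_iff)
    then show "?Inv 0 (layout inp ?R1 h b u)" using s1 by (intro exI[of _ ?R1]) simp
  next
    show "bounded_mem width m" if "?Inv a m" for a m using that small(3) small_s bounded_state by blast
  next
    show "val m idx = 0" if "?Inv ?N m" for m using that by auto
  qed (simp add: expr_size_reg)
  moreover have "?s ?N f = (\<lambda>k. f k * common)" for f by auto
  ultimately obtain R where R: "exec width (Loop idx rescale_step) (layout inp ?R1 h b u)
      (layout inp R (\<lambda>k. h k * common) b (\<lambda>k. u k * common)) (?N * (5 + 1) + 1)"
    "small R" "\<forall>k. k \<noteq> 9 \<longrightarrow> R k = R0 k" by auto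
  have "exec width rescale (layout inp R0 h b u) (layout inp R (\<lambda>k. h k * common) b (\<lambda>k. u k * common))
      (1 + 1 + (?N * (5 + 1) + 1))"
    unfolding rescale_def by (rule exec_Seq[OF 1 R(1)])
  then have "exec width rescale (layout inp R0 h b u) (layout inp R (\<lambda>k. h k * common) b (\<lambda>k. u k * common))
      (6 * ?N + 3)"
    by (rule exec_mono) simp
  then show ?thesis using R(2,3) by blast
qed

section \<open>The invariant of the planning rounds and its preservation\<close>

lemma scaled_less_width:
  assumes "real y = real common ^ k * x" "k \<le> B + 1" "x \<le> real (B + 1) * 2 ^ input_size I"
  shows "y < 2 ^ width"
proof (rule less_width3)
  have "real y \<le> real common ^ k * (real (B + 1) * 2 ^ input_size I)"
    unfolding assms(1) by (intro mult_left_mono assms(3)) simp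
  also have "\<dots> \<le> real common ^ (B + 1) * (real (B + 1) * 2 ^ input_size I)"
    using common_pos assms(2) by (intro mult_right_mono power_increasing) auto
  also have "\<dots> = real (common ^ (B + 1) * ((B + 1) * 2 ^ input_size I))"
    by (simp only: of_nat_mult of_nat_power of_nat_numeral)
  finally show "y \<le> common ^ (B + 1) * ((B + 1) * 2 ^ input_size I)" by (simp only: of_nat_le_iff)
qed

text \<open>After \<open>a\<close> rounds the steps from \<open>B - a + 1\<close> to
  \<open>B\<close> are priced. The arrays hold the remaining prices (\<open>h\<close>), the
  attribution (\<open>b\<close>) and the totals per job (\<open>u\<close>); both numeric arrays are
  scaled by the power \<open>a + 1\<close>, one more than register 1, so that they match scaled
  rewards.\<close>

definition planned :: "nat \<Rightarrow> (nat \<Rightarrow> nat) \<Rightarrow> (nat \<Rightarrow> nat) \<Rightarrow> (nat \<Rightarrow> nat) \<Rightarrow> (nat \<Rightarrow> nat) \<Rightarrow> (nat \<Rightarrow> real) \<Rightarrow> bool" where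
  "planned a R h b u v \<longleftrightarrow> small R \<and> R 0 = common \<and> R 1 = common ^ a \<and> R 2 = B - a \<and>
     balanced v b (B - a + 1) \<and> (\<forall>k. b k \<le> q) \<and>
     (\<forall>k. real (h k) = of_bool (B - a < k) * (real common ^ (a + 1) * tail_price v k)) \<and>
     (\<forall>i. real (u i) = real common ^ (a + 1) * job_price v b i (B - a))"

lemma tail_price_bound:
  assumes "balanced v b t0" "t0 \<le> t" "1 \<le> t"
  shows "tail_price v t \<le> real (B + 1) * 2 ^ input_size I"
  using tail_price_le[OF assms(1,2)] by (rule order_trans) (intro mult_right_mono, auto)

lemma planned_small:
  assumes "planned a R h b u v" "k \<le> B + 1"
  shows "real y = real common ^ k * tail_price v t \<Longrightarrow> B - a < t \<Longrightarrow> y < 2 ^ width"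
    "real y = real common ^ k * job_price v b i (B - a) \<Longrightarrow> y < 2 ^ width"
proof -
  have bal: "balanced v b (B - a + 1)" using assms(1) by (simp add: planned_def)
  show "y < 2 ^ width" if "real y = real common ^ k * tail_price v t" "B - a < t"
    using tail_price_bound[OF bal, of t] that by (intro scaled_less_width[OF that(1) assms(2)]) simp
  show "y < 2 ^ width" if "real y = real common ^ k * job_price v b i (B - a)"
    using tail_price_bound[OF bal, of "B - a + 1"] job_price_bounds(2)[OF bal, of i]
    by (intro scaled_less_width[OF that assms(2)]) simp
qed

lemma planned_smallD:
  assumes "planned a R h b u v" "a \<le> B"
  shows "small R" "small h" "small b" "small u"
proof -
  show "small R" using assms by (simp add: planned_def)
  show "small b" using assms less_width2 unfolding small_def planned_def by (meson trans_le_add1)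
  have "h k < 2 ^ width" for k
  proof (cases "B - a < k")
    case True
    then show ?thesis using assms by (intro planned_small(1)[OF assms(1), of "a + 1" _ k]) (auto simp: planned_def)
  next
    case False
    then have "real (h k) = 0" using assms by (simp add: planned_def)
    then show ?thesis by simp
  qed
  then show "small h" by (simp add: small_def)
  have "u i < 2 ^ width" for i
    using assms by (intro planned_small(2)[OF assms(1), of "a + 1" _ i]) (auto simp: planned_def)
  then show "small u" by (simp add: small_def)
qed

lemma planned_0:
  assumes "small R" "R 0 = common" "R 1 = 1" "R 2 = B"
  shows "planned 0 R (\<lambda>_. 0) (\<lambda>_. 0) (\<lambda>_. 0) (\<lambda>_. 0)"
  using assms by (simp add: planned_def balanced_def tail_price_def job_price_def)

lemma real_diff_nat: "real (x - y) = max 0 (real x - real y)"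
  by (cases "y \<le> x") (auto simp: of_nat_diff)

lemma real_job_gain:
  assumes pl: "planned a R h b u v" and i: "i < n"
  shows "real (job_gain (common ^ a) h u (B - a) i) = max 0 (real common ^ (a + 2) * gain v b i (B - a))"
    "a < B \<Longrightarrow> job_value (common ^ a) h (B - a) i < 2 ^ width"
proof -
  let ?t = "B - a"
  have jv: "real (job_value (common ^ a) h ?t i) = real common ^ (a + 2) * E i (payoff (tail_price v) ?t)"
    using pl by (subst job_value_eq[OF i, where v = v]) (simp_all add: planned_def algebra_simps power2_eq_square)
  have "real (common * (h (?t + 1) + u i)) = real common ^ (a + 2) * (tail_price v (?t + 1) + job_price v b i ?t)"
    using pl by (simp add: planned_def algebra_simps)
  then show "real (job_gain (common ^ a) h u ?t i) = max 0 (real common ^ (a + 2) * gain v b i ?t)"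
    unfolding job_gain_def real_diff_nat jv gain_def by (simp add: algebra_simps)
  have bal: "balanced v b (?t + 1)" using pl by (simp add: planned_def)
  assume a: "a < B"
  have "E i (payoff (tail_price v) ?t) \<le> 2 ^ input_size I + real (B + 1 - (?t + 1)) * 2 ^ input_size I"
    using payoff_le[OF bal i] tail_price_le[OF bal order_refl] by linarith
  also have "\<dots> = real (1 + a) * 2 ^ input_size I" using a by (simp add: algebra_simps)
  also have "\<dots> \<le> real (B + 1) * 2 ^ input_size I" using a by (intro mult_right_mono) auto
  finally show "job_value (common ^ a) h ?t i < 2 ^ width"
    using a by (intro scaled_less_width[OF jv]) auto
qed

lemma planned_Suc:
  assumes pl: "planned a R h b u v" and a: "a < B"
    and best: "best_among (job_gain (common ^ a) h u (B - a)) n x y"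
    and R': "small R'" "R' 0 = common" "R' 1 = common ^ Suc a" "R' 2 = B - Suc a"
  shows "\<exists>v'. planned (Suc a) R' ((\<lambda>k. h k * common)(B - a := h (B - a + 1) * common + x)) (b(B - a := y))
      ((\<lambda>k. u k * common)(y := u y * common + x)) v'"
proof -
  define t where "t = B - a"
  define c where "c = real common ^ (a + 2)"
  have c: "0 < c" using common_pos by (simp add: c_def)
  have t: "1 \<le> t" "t \<le> B" "B - Suc a = t - 1" using a by (auto simp: t_def)
  note pl' = pl[unfolded planned_def, folded t_def] and best' = best[folded t_def]
  note gain = real_job_gain(1)[OF pl, folded c_def t_def]
  let ?g = "job_gain (common ^ a) h u t"
  have h: "real (h k) * real common = of_bool (t < k) * (c * tail_price v k)" for k
    using pl' by (simp add: c_def)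
  have u: "real (u i) * real common = c * job_price v b i t" for i
    using pl' by (simp add: c_def)
  \<comment> \<open>\<open>x\<close> is the integer that the program computes; \<open>c\<close> is
    the scale of the arrays after this round, so the quotient is the true price.\<close>
  let ?x = "real x / c"
  let ?v = "v(t := ?x)" and ?b = "b(t := y)"
  have cx: "c * ?x = real x" using c by simp
  have bal: "balanced ?v ?b t"
  proof (rule balanced_extend)
    show "balanced v b (t + 1)" using pl' by blast
    show "0 \<le> ?x" using c by simp
    show "gain v b i t \<le> ?x" if "i < n" for i
    proof -
      have "c * gain v b i t \<le> real (?g i)" unfolding gain[OF that] by simp
      also have "\<dots> \<le> real x" using best' that by (simp add: best_among_def)
      finally show ?thesis using c by (simp add: pos_le_divide_eq mult.commute)
    qed
    show "?x = (if y < n then gain v b y t else 0)"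
    proof (cases "y < n")
      case True
      then have "x = ?g y" "0 < x" using best' n_less_q by (auto simp: best_among_def)
      then have "real x = c * gain v b y t"
        using gain[OF True] by (auto simp: max_def split: if_splits)
      then show ?thesis using c True by simp
    next
      case False
      then show ?thesis using best' by (auto simp: best_among_def)
    qed
  qed
  have le: "\<forall>k. ?b k \<le> q"
    using pl' best' n_less_q by (auto simp: best_among_def)
  have new_h: "\<forall>k. real (((\<lambda>k. h k * common)(t := h (t + 1) * common + x)) k)
      = of_bool (t - 1 < k) * (c * tail_price ?v k)"
  proof
    fix k
    consider "k < t" | "k = t" | "t < k" by linarith
    then show "real (((\<lambda>k. h k * common)(t := h (t + 1) * common + x)) k)
      = of_bool (t - 1 < k) * (c * tail_price ?v k)"
    proof cases
      case 2
      have "tail_price ?v t = ?x + tail_price v (t + 1)"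
        using tail_price_rec[OF t(2), of ?v] tail_price_upd[of t "t + 1" v ?x] by simp
      then have "c * tail_price ?v t = real x + c * tail_price v (t + 1)"
        using cx by (simp only: distrib_left)
      then show ?thesis using 2 h[of "t + 1"] t by simp
    next
      case 3
      then have "t - 1 < k" by simp
      then show ?thesis using 3 h by (simp add: tail_price_upd)
    qed (use h t in simp)
  qed
  have new_u: "\<forall>i. real (((\<lambda>k. u k * common)(y := u y * common + x)) i) = c * job_price ?v ?b i (t - 1)"
  proof
    fix i
    have "job_price ?v ?b i (t - 1) = of_bool (y = i) * ?x + job_price v b i t"
      using job_price_pred[OF t(1,2), of ?v ?b i] job_price_upd[of t t v ?x b y i] by simp
    then have "c * job_price ?v ?b i (t - 1) = of_bool (y = i) * real x + c * job_price v b i t"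
      using cx by (auto simp: distrib_left)
    then show "real (((\<lambda>k. u k * common)(y := u y * common + x)) i) = c * job_price ?v ?b i (t - 1)"
      using u[of i] by auto
  qed
  have "real common ^ (Suc a + 1) = c" "t - 1 + 1 = t" using t by (simp_all add: c_def)
  then have "planned (Suc a) R' ((\<lambda>k. h k * common)(t := h (t + 1) * common + x)) ?b
      ((\<lambda>k. u k * common)(y := u y * common + x)) ?v"
    unfolding planned_def t(3) using R'[unfolded t(3)] bal le new_h new_u by metis
  then show ?thesis unfolding t_def by blast
qed

lemma exec_time_step:
  assumes pl: "planned a R0 h b u v" and a: "a < B"
  shows "\<exists>R h' b' u' v'. exec width time_step (layout inp R0 h b u) (layout inp R h' b' u')
      (n * (8 * q + 16) + 6 * (q + B + 2) + 24) \<and> planned (Suc a) R h' b' u' v'"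
proof -
  let ?t = "B - a" let ?f = "common ^ a"
  note small = planned_smallD[OF pl less_imp_le[OF a]]
  have R0: "R0 0 = common" "R0 1 = ?f" "R0 2 = ?t" using pl by (simp_all add: planned_def)
  let ?R1 = "R0(7 := 0, 8 := q, 5 := 0, 3 := 2)"
  have qw: "q < 2 ^ width" "B < 2 ^ width" by (auto intro: less_width2)
  have s1: "small ?R1" using small(1) qw width_ge[of 0] width_ge[of 2] by (auto intro!: small_upd)
  have 1: "exec width time_start (layout inp R0 h b u) (layout inp ?R1 h b u) 7"
    by (rule exec_block[OF straight_code(6) small, unfolded num_steps_code])
      (use qw width_ge[of 2] in \<open>simp_all add: time_start_def\<close>)
  obtain R2 where 2: "exec width (Loop (Sub input_end ptr) job_step) (layout inp ?R1 h b u) (layout inp R2 h b u)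
      (n * (8 * q + 16) + 1)" and R2: "small R2" "R2 0 = common" "R2 1 = ?f" "R2 2 = ?t"
      and best: "best_among (job_gain ?f h u ?t) n (R2 7) (R2 8)"
    using exec_jobs[OF s1 small(2-), of ?f ?t] R0 real_job_gain(2)[OF pl _ a] by auto
  have hk: "h k * common < 2 ^ width" for k
  proof (cases "?t < k")
    case True
    then show ?thesis
      using pl a by (intro planned_small(1)[OF pl, of "a + 2" _ k]) (simp_all add: planned_def algebra_simps)
  next
    case False
    then have "real (h k) = 0" using pl by (simp add: planned_def)
    then show ?thesis by simp
  qed
  have uk: "u k * common < 2 ^ width" for k
    using pl a by (intro planned_small(2)[OF pl, of "a + 2" _ k]) (simp_all add: planned_def algebra_simps)
  have hz: "h k = 0" if "q + B + 2 \<le> k" for k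
  proof -
    have "real (h k) = 0" using pl that by (simp add: planned_def tail_price_beyond)
    then show ?thesis by simp
  qed
  have uz: "u k = 0" if "q + B + 2 \<le> k" for k
  proof -
    have "b \<tau> \<noteq> k" for \<tau>
    proof -
      have "b \<tau> \<le> q" using pl by (simp add: planned_def)
      then show ?thesis using that by simp
    qed
    then have "job_price v b k ?t = 0" by (simp add: job_price_def)
    then have "real (u k) = 0" using pl by (simp add: planned_def)
    then show ?thesis by simp
  qed
  let ?h = "\<lambda>k. h k * common" and ?u = "\<lambda>k. u k * common"
  obtain R3 where 3: "exec width rescale (layout inp R2 h b u) (layout inp R3 ?h b ?u) (6 * (q + B + 2) + 3)"
    and R3: "small R3" "\<forall>k. k \<noteq> 9 \<longrightarrow> R3 k = R2 k"
    using exec_rescale[OF R2(1) small(2-) R2(2) hk uk hz uz] by auto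
  have regs: "R3 0 = common" "R3 1 = ?f" "R3 2 = ?t" "R3 7 = R2 7" "R3 8 = R2 8"
    using R3(2) R2 by simp_all
  let ?x = "R2 7" and ?y = "R2 8"
  let ?R4 = "R3(1 := ?f * common, 2 := ?t - 1)"
  let ?h4 = "?h(?t := h (?t + 1) * common + ?x)" and ?b4 = "b(?t := ?y)" and ?u4 = "?u(?y := u ?y * common + ?x)"
  have one: "1 \<le> (B + 1) * 2 ^ input_size I"
    using mult_le_mono[of 1 "B + 1" 1 "2 ^ input_size I"] by simp
  have "?f * common \<le> common ^ (B + 1)"
    using common_pos a by (simp add: mult.commute power_Suc[symmetric] del: power_Suc) (intro power_increasing; simp)
  also have "\<dots> \<le> common ^ (B + 1) * ((B + 1) * 2 ^ input_size I)"
    using mult_le_mono2[OF one, of "common ^ (B + 1)"] by (simp only: mult_1_right)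
  finally have fw: "?f * common < 2 ^ width" by (rule less_width3)
  have tw: "?t - 1 < 2 ^ width" using qw(2) by simp
  have s4: "small ?R4" using R3(1) fw tw by (auto intro!: small_upd)
  \<comment> \<open>The next invariant is established before the last block is executed: its price
    bounds are what shows that the values to be written fit.\<close>
  obtain v' where pl': "planned (Suc a) ?R4 ?h4 ?b4 ?u4 v'"
    using planned_Suc[OF pl a best s4] regs by (auto simp: mult.commute)
  note small4 = planned_smallD[OF pl' Suc_leI[OF a]]
  have w: "h (?t + 1) * common + ?x < 2 ^ width" "u ?y * common + ?x < 2 ^ width"
    using smallD[OF small4(2), of ?t] smallD[OF small4(4), of ?y] by simp_all
  have s3: "small ?h" "small ?u" using hk uk by (simp_all add: small_def)
  have 4: "exec width time_finish (layout inp R3 ?h b ?u) (layout inp ?R4 ?h4 ?b4 ?u4) 9"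
    by (rule exec_block[OF straight_code(7) R3(1) s3(1) small(3) s3(2), unfolded num_steps_code])
      (use regs fw tw w smallD[OF R2(1), of 8] in \<open>simp_all add: time_finish_def decr_def\<close>)
  have "exec width time_step (layout inp R0 h b u) (layout inp ?R4 ?h4 ?b4 ?u4)
      (1 + 7 + (1 + (n * (8 * q + 16) + 1) + (1 + (6 * (q + B + 2) + 3) + 9)))"
    unfolding time_step_def by (intro exec_Seq[OF 1] exec_Seq[OF 2] exec_Seq[OF 3] 4)
  then have "exec width time_step (layout inp R0 h b u) (layout inp ?R4 ?h4 ?b4 ?u4)
      (n * (8 * q + 16) + 6 * (q + B + 2) + 24)"
    by (rule exec_mono) simp
  then show ?thesis using pl' by blast
qed

lemma exec_make_plan:
  assumes "small R0" "R0 0 = common"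
  shows "\<exists>R h b u v. exec width make_plan (layout inp R0 (\<lambda>_. 0) (\<lambda>_. 0) (\<lambda>_. 0)) (layout inp R h b u)
      (B * (n * (8 * q + 16) + 6 * (q + B + 2) + 25) + 5) \<and> planned B R h b u v"
proof -
  let ?z = "\<lambda>_::nat. 0::nat"
  have z: "small ?z" by (simp add: small_def)
  have Bw: "B < 2 ^ width" by (rule less_width2) simp
  let ?R1 = "R0(1 := 1)" let ?R2 = "?R1(2 := B)"
  have s1: "small ?R1" using assms(1) width_ge[of 1] by (intro small_upd) auto
  have s2: "small ?R2" using s1 Bw by (rule small_upd)
  have 1: "exec width (set_reg 1 (Lit 1)) (layout inp R0 ?z ?z ?z) (layout inp ?R1 ?z ?z ?z) 1"
    using exec_block[of "set_reg 1 (Lit 1)" R0 ?z ?z ?z] assms z width_ge[of 1] by (simp add: bits_numerals)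
  have 2: "exec width (set_reg 2 time_budget) (layout inp ?R1 ?z ?z ?z) (layout inp ?R2 ?z ?z ?z) 1"
    using exec_block[of "set_reg 2 time_budget" ?R1 ?z ?z ?z] s1 z Bw by (simp add: bits_numerals)
  let ?K = "n * (8 * q + 16) + 6 * (q + B + 2) + 24"
  let ?Inv = "\<lambda>a m. \<exists>R h b u v. m = layout inp R h b u \<and> planned a R h b u v"
  have "\<exists>m'. exec width (Loop now time_step) (layout inp ?R2 ?z ?z ?z) m' (B * (?K + 1) + 1) \<and> ?Inv B m'"
  proof (rule exec_Loop[where Inv = ?Inv])
    fix a m assume a: "a < B" and "?Inv a m"
    then obtain R h b u v where m: "m = layout inp R h b u" and pl: "planned a R h b u v" by blast
    have "val m now \<noteq> 0" using pl a by (simp add: m planned_def)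
    then show "val m now \<noteq> 0 \<and> (\<exists>m'. exec width time_step m m' ?K \<and> ?Inv (Suc a) m')"
      using exec_time_step[OF pl a] unfolding m by blast
  next
    show "val m now = 0" if "?Inv B m" for m using that by (auto simp: planned_def)
  next
    fix a m assume a: "a \<le> B" and "?Inv a m"
    then obtain R h b u v where m: "m = layout inp R h b u" and pl: "planned a R h b u v" by blast
    show "bounded_mem width m" unfolding m by (rule bounded_state[OF planned_smallD[OF pl a]])
  next
    show "?Inv 0 (layout inp ?R2 ?z ?z ?z)"
    proof (intro exI conjI)
      show "planned 0 ?R2 ?z ?z ?z (\<lambda>_. 0)" using assms(2) by (intro planned_0 s2) simp_all
    qed (rule refl)
  qed (simp add: expr_size_reg)
  then obtain R h b u v where 3: "exec width (Loop now time_step) (layout inp ?R2 ?z ?z ?z) (layout inp R h b u)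
      (B * (?K + 1) + 1)" "planned B R h b u v" by blast
  have "exec width make_plan (layout inp R0 ?z ?z ?z) (layout inp R h b u) (1 + 1 + (1 + 1 + (B * (?K + 1) + 1)))"
    unfolding make_plan_def by (intro exec_Seq[OF 1] exec_Seq[OF 2] 3(1))
  then have "exec width make_plan (layout inp R0 ?z ?z ?z) (layout inp R h b u) (B * (?K + 1) + 5)"
    by (rule exec_mono) simp
  moreover have "?K + 1 = n * (8 * q + 16) + 6 * (q + B + 2) + 25" by simp
  ultimately show ?thesis using 3(2) by (intro exI conjI) (simp only:)
qed

subsection \<open>Execution of the plan\<close>

definition plan_potential :: "(nat \<Rightarrow> real) \<Rightarrow> (nat \<Rightarrow> nat) \<Rightarrow> env \<Rightarrow> real" where
  "plan_potential v b e = env_reward e + plan_value v b (fst e) (fst (snd e))"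

lemma plan_potential_step:
  assumes bal: "balanced v b 1" and t: "1 \<le> t" "t \<le> B" "fst e = t \<or> B < fst e"
  shows "plan_potential v b e \<le>
    measure_pmf.expectation (env_step I (Start (b t)) e) (\<lambda>y. plan_potential v b (snd y))"
proof -
  obtain t' A w where e: "e = (t', A, w)" by (cases e)
  show ?thesis
  proof (cases "t' = t \<and> b t < n \<and> b t \<notin> A")
    case True
    let ?i = "b t"
    let ?next = "\<lambda>(s, r). if t + s - 1 \<le> B then (Some (s, r), (t + s, insert ?i A, w + of_rat r))
                else (None, (t + s, insert ?i A, w))"
    have nxt: "plan_potential v b (snd (?next z)) = w + payoff (\<lambda>t'. plan_value v b t' (insert ?i A)) t z" for z
      using t by (auto simp: plan_potential_def payoff_def env_reward_def split: prod.split)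
    have "plan_potential v b e = w + plan_value v b t A"
      using True by (simp add: e plan_potential_def env_reward_def)
    also have "\<dots> \<le> E ?i (\<lambda>z. w + payoff (\<lambda>t'. plan_value v b t' (insert ?i A)) t z)"
      using plan_value_start[OF bal t(1,2)] True by (simp add: E_add)
    also have "\<dots> = measure_pmf.expectation (env_step I (Start ?i) e) (\<lambda>y. plan_potential v b (snd y))"
      using True t unfolding nxt[symmetric] by (simp add: e env_step_def E_def)
    finally show ?thesis .
  next
    case False
    consider "B < t'" | "t' = t" using t(3) by (auto simp: e)
    then show ?thesis
    proof cases
      case 1
      then show ?thesis by (simp add: e env_step_def)
    next
      case 2
      \<comment> \<open>Idling here loses nothing: either \<open>b t\<close> is not a job and the
        price is 0, or the job was started earlier and the price is no longer counted.\<close>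
      have "of_bool (b t \<notin> A) * v t = 0"
      proof (cases "b t < n")
        case False
        then have "v t = 0" using bal t unfolding balanced_def by auto
        then show ?thesis by simp
      qed (use False 2 in simp)
      then show ?thesis
        using False 2 t plan_value_rec[OF t(2), of v b A]
        by (auto simp: e env_step_def plan_potential_def env_reward_def)
    qed
  qed
qed

text \<open>\<open>d + (1 - d)\<close> is \<open>max 1 d\<close>, the advance of the program's
  clock. Duration 0 stands for a step of idling or for an overrun; the two clocks can disagree only
  once the budget is exhausted.\<close>

lemma launch_outcome:
  assumes t: "1 \<le> t" "t \<le> B" "fst e = t \<or> B < fst e" and y: "(ob, e') \<in> set_pmf (env_step I (Start i) e)"
  obtains d x z where "observation_code ob = [d, x, z]" "d < 2 ^ width" "x < 2 ^ width" "z < 2 ^ width"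
    "t < t + (d + (1 - d))" "t + (d + (1 - d)) \<le> B + 1" "fst e' = t + (d + (1 - d)) \<or> B < fst e'"
proof -
  obtain t' A w where e: "e = (t', A, w)" by (cases e)
  consider (finish) s r where "ob = Some (s, r)" "i < n" "(s, r) \<in> set_pmf (job_pmf I i)" "t' = t" "t + s - 1 \<le> B" "fst e' = t + s"
    | (none) "ob = None" "fst e' = t + 1 \<or> B < fst e'"
    using y t(1,3) by (fastforce simp: e env_step_def split: if_splits)
  then show ?thesis
  proof cases
    case finish
    then have "s \<ge> 1" "num r < 2 ^ width" "den r < 2 ^ width"
      using job_support_valid reward_less less_width4 by blast+
    moreover have "s < 2 ^ width" using finish t by (intro less_width2) simp
    ultimately show ?thesis
      using finish t by (intro that[of s "num r" "den r"]) (auto simp: observation_code_def rat_code_eq)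
  next
    case none
    then show ?thesis
      using t by (intro that[of 0 0 0]) (auto simp: observation_code_def)
  qed
qed

lemma store_observation:
  "store (val (layout inp R h b u) (reg_addr 10)) [d, x, z] (layout inp R h b u)
    = layout inp (R(10 := d, 11 := x, 12 := z)) h b u"
proof -
  have "store (q + 10) [d, x, z] m = m(q + 10 := d, q + 11 := x, q + 12 := z)" for m
    by (auto simp: store_def fun_eq_iff nth_Cons split: nat.splits)
  moreover have "(10 :: nat) < 16" "(11 :: nat) < 16" "(12 :: nat) < 16" by simp_all
  ultimately show ?thesis by (simp only: val_reg_addr[OF q_ge_2] layout_upd_reg[OF q_ge_2])
qed

text \<open>After an overrun the program keeps launching, but the process no longer changes, so the
  disjunction on \<open>fst e\<close> is preserved. An iteration is charged four units: guard,
  unfolding of \<open>act\<close>, launch and clock update; the exit guard takes one more.\<close>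

lemma good_follow:
  assumes bal: "balanced v b 1" and small: "small h" "small b" "small u"
  shows "small R \<Longrightarrow> R 2 = t \<Longrightarrow> 1 \<le> t \<Longrightarrow> t + j = B + 1 \<Longrightarrow> fst e = t \<or> B < fst e \<Longrightarrow>
    T + (4 * j + 1) * unit_cost width \<le> bnd \<Longrightarrow>
    good I bnd ([Loop (Sub (Add time_budget (Lit 1)) now) act], layout inp R h b u, e, T) (plan_potential v b e)"
proof (induction j arbitrary: R t e T rule: less_induct)
  case (less j)
  let ?U = "unit_cost width" and ?guard = "Sub (Add time_budget (Lit 1)) now"
  let ?m = "layout inp R h b u"
  have bm: "bounded_mem width ?m" using less.prems(1) small by (rule bounded_state)
  have guard: "val ?m ?guard = B + 1 - t" using less.prems(2) by simp
  have size: "expr_size ?guard \<le> 200" by (simp add: reg_addr_def bits_numerals)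
  have gcost: "1 + cost ?m ?guard \<le> ?U" by (rule cost_small1[OF bm size])
  show ?case
  proof (cases "j = 0")
    case True
    then have "B < fst e" using less.prems by auto
    then have pot: "plan_potential v b e = env_reward e" by (simp add: plan_potential_def plan_value_beyond)
    have "good I bnd ([], ?m, e, T + 1 + cost ?m ?guard) (plan_potential v b e)"
      unfolding pot by (rule good.halt) (use less.prems(6) True gcost in auto)
    then show ?thesis
      by (rule good_det[rotated 2]) (use guard less.prems(4) True in simp_all)
  next
    case False
    then have t: "1 \<le> t" "t \<le> B" using less.prems by auto
    let ?loop = "Loop ?guard act"
    let ?fin = "set_reg 2 (Add now (Add duration (Sub (Lit 1) duration)))"
    have "good I bnd ([Launch (cell 1 now) (reg_addr 10), ?fin, ?loop], ?m, e, T + 2 * ?U) (plan_potential v b e)"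
    proof (rule good.step[where f = "\<lambda>(cs, m, e, T). plan_potential v b e"])
      show "plan_potential v b e \<le> measure_pmf.expectation
         (step I ([Launch (cell 1 now) (reg_addr 10), ?fin, ?loop], ?m, e, T + 2 * ?U)) (\<lambda>(cs, m, e, T). plan_potential v b e)"
        using plan_potential_step[OF bal t less.prems(5)] less.prems(2) by (simp add: split_beta)
    next
      fix C' assume "C' \<in> set_pmf (step I ([Launch (cell 1 now) (reg_addr 10), ?fin, ?loop], ?m, e, T + 2 * ?U))"
      then obtain ob e' where y: "(ob, e') \<in> set_pmf (env_step I (Start (b t)) e)"
        and C': "C' = ([?fin, ?loop], store (val ?m (reg_addr 10)) (observation_code ob) ?m, e',
          T + 2 * ?U + 1 + cost ?m (cell 1 now) + cost ?m (reg_addr 10) + sum_list (map bits (observation_code ob)))"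
        using less.prems(2) by auto
      obtain d x z where ob: "observation_code ob = [d, x, z]" and w: "d < 2 ^ width" "x < 2 ^ width" "z < 2 ^ width"
        and new: "t < t + (d + (1 - d))" "t + (d + (1 - d)) \<le> B + 1" "fst e' = t + (d + (1 - d)) \<or> B < fst e'"
        by (rule launch_outcome[OF t less.prems(5) y])
      let ?t = "t + (d + (1 - d))" and ?R1 = "R(10 := d, 11 := x, 12 := z)"
      let ?R2 = "?R1(2 := ?t)"
      have tw: "?t < 2 ^ width" using new(2) by (intro less_width2) simp
      have s1: "small ?R1" using less.prems(1) w by (auto intro!: small_upd)
      have s2: "small ?R2" using s1 tw by (rule small_upd)
      have fin: "exec width ?fin (layout inp ?R1 h b u) (layout inp ?R2 h b u) 1"
      proof -
        have "straight ?fin" by (simp add: reg_addr_def bits_numerals)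
        moreover have "fits width ?fin (layout inp ?R1 h b u)" "result ?fin (layout inp ?R1 h b u) = layout inp ?R2 h b u"
          using less.prems(2) tw by simp_all
        ultimately have "exec width ?fin (layout inp ?R1 h b u) (layout inp ?R2 h b u) (num_steps ?fin)"
          by (intro exec_block s1 small)
        then show ?thesis by (simp only: set_reg_props)
      qed
      have "cost ?m (cell 1 now) \<le> 40200 * (width + 1)" "cost ?m (reg_addr 10) \<le> 40200 * (width + 1)"
        by (rule cost_small[OF bm]; simp add: reg_addr_def cell_addr_def bits_numerals)+
      moreover have "bits d \<le> width" "bits x \<le> width" "bits z \<le> width" using w by (simp_all add: bits_le_iff)
      ultimately have time: "1 + cost ?m (cell 1 now) + cost ?m (reg_addr 10) + sum_list (map bits [d, x, z]) \<le> ?U"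
        unfolding unit_cost_def by simp
      define j' where "j' = B + 1 - ?t"
      have j': "j' < j" "?t + j' = B + 1" using new less.prems(4) by (auto simp: j'_def)
      have "good I bnd ([?loop], layout inp ?R2 h b u, e', (T + 3 * ?U) + 1 * ?U) (plan_potential v b e')"
      proof (rule less.IH[OF j'(1) s2 _ _ j'(2) new(3)])
        have "4 + (4 * j' + 1) \<le> 4 * j + 1" using j'(1) by simp
        then have "(4 + (4 * j' + 1)) * ?U \<le> (4 * j + 1) * ?U" by (rule mult_le_mono1)
        then show "T + 3 * ?U + 1 * ?U + (4 * j' + 1) * ?U \<le> bnd"
          using less.prems(6) by (simp add: add_mult_distrib)
      qed (use t in auto)
      then have "good I bnd ([?fin, ?loop], layout inp ?R1 h b u, e', T + 3 * ?U) (plan_potential v b e')"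
        by (rule execD[OF fin])
      then show "good I bnd C' (case C' of (cs, m, e, T) \<Rightarrow> plan_potential v b e)"
        unfolding C' ob store_observation prod.case
        by (rule good_earlier) (use time in simp)
    qed simp
    then have "good I bnd ([Launch (cell 1 now) (reg_addr 10), ?fin, ?loop], ?m, e, T + ?U + 1) (plan_potential v b e)"
      by (rule good_earlier) (use unit_cost_pos[of width] in simp)
    then have "good I bnd ([act, ?loop], ?m, e, T + ?U) (plan_potential v b e)"
      by (rule good_det[rotated 2]) (simp_all add: act_def)
    then have "good I bnd ([act, ?loop], ?m, e, T + 1 + cost ?m ?guard) (plan_potential v b e)"
      by (rule good_earlier) (use gcost in simp)
    then show ?thesis
      by (rule good_det[rotated 2]) (use guard t in simp_all)
  qed
qed

section \<open>Accounting of the running time and assembly of the phases\<close>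

definition total_steps :: nat where
  "total_steps = (2 * n + 3) + (6 * q + 5) + (B * (n * (8 * q + 16) + 6 * (q + B + 2) + 25) + 5) + (4 * B + 1) + 10"

text \<open>Cubic because of \<open>B\<close> rounds, at most \<open>n\<close> jobs per round, and a
  bound of order \<open>q\<close> for each job. 49 is the largest coefficient of the polynomial
  \<open>8 * S^3 + 22 * S^2 + 49 * S + 24\<close> that results, with \<open>S\<close> the input
  size.\<close>

lemma total_steps_le: "total_steps \<le> 49 * (input_size I + 1) ^ 3"
proof -
  let ?S = "input_size I"
  have le: "n \<le> ?S" "q \<le> ?S" "B \<le> ?S" "q + B \<le> ?S" using input_size_ge(1) n_less_q by auto
  have "n * (8 * q + 16) \<le> ?S * (8 * ?S + 16)" by (intro mult_le_mono le add_mono order_refl)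
  moreover have "6 * (q + B + 2) \<le> 6 * (?S + 2)" using le(4) by simp
  ultimately have "B * (n * (8 * q + 16) + 6 * (q + B + 2) + 25) \<le> ?S * (?S * (8 * ?S + 16) + 6 * (?S + 2) + 25)"
    by (intro mult_le_mono le add_mono order_refl)
  then have "total_steps \<le> 2 * ?S + 6 * ?S + ?S * (?S * (8 * ?S + 16) + 6 * (?S + 2) + 25) + 4 * ?S + 24"
    using le unfolding total_steps_def by linarith
  also have "\<dots> \<le> 49 * (?S + 1) ^ 3"
    by (simp add: power3_eq_cube algebra_simps)
  finally show ?thesis .
qed

text \<open>Cubically many units, each linear in \<open>width\<close>, which is again cubic; the
  factors 49, 100000 and 5 multiply to less than the constant.\<close>

lemma time_bound: "total_steps * unit_cost width \<le> 100000000 * (input_size I + 1) ^ 6"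
proof -
  let ?S = "input_size I"
  have "width + 1 \<le> 5 * (?S + 1) ^ 3"
    by (simp add: width_def power3_eq_cube algebra_simps)
  then have "total_steps * unit_cost width \<le> (49 * (?S + 1) ^ 3) * (100000 * (5 * (?S + 1) ^ 3))"
    unfolding unit_cost_def by (intro mult_le_mono total_steps_le order_refl)
  also have "\<dots> = 24500000 * (?S + 1) ^ 6"
    by (simp add: power_add[symmetric] del: add_Suc_right)
  also have "\<dots> \<le> 100000000 * (?S + 1) ^ 6"
    by (intro mult_le_mono1) simp
  finally show ?thesis .
qed

lemma good_Seq:
  "exec width c1 m m1 k1 \<Longrightarrow> good I b (c2 # cs, m1, e, T + 1 + k1 * unit_cost width) v \<Longrightarrow>
    good I b (Seq c1 c2 # cs, m, e, T) v"
  by (rule good_det[OF _ _ execD[of width c1 m m1 k1]]) (simp_all only: step.simps list.simps fst_conv simp_thms)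

lemma good_program:
  obtains v where "OPT_LP I \<le> 2 * v" "OPT_policy I \<le> 2 * v"
    "good I (total_steps * unit_cost width) (init_config I program) v"
proof -
  let ?z = "\<lambda>_::nat. 0::nat" and ?U = "unit_cost width"
  have z: "small ?z" by (simp add: small_def)
  obtain R1 where 1: "exec width find_scale (layout inp ?z ?z ?z ?z) (layout inp R1 ?z ?z ?z) (6 * q + 5)"
    and R1: "small R1" "R1 0 = common"
    using exec_find_scale[OF z z z z] by blast
  obtain R2 h b u v where 2: "exec width make_plan (layout inp R1 ?z ?z ?z) (layout inp R2 h b u)
      (B * (n * (8 * q + 16) + 6 * (q + B + 2) + 25) + 5)" and pl: "planned B R2 h b u v"
    using exec_make_plan[OF R1] by blast
  note small = planned_smallD[OF pl order_refl]
  have bal: "balanced v b 1" using pl by (simp add: planned_def)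
  let ?R3 = "R2(2 := 1)"
  have s3: "small ?R3" using small(1) width_ge[of 1] by (intro small_upd) auto
  have 3: "exec width (set_reg 2 (Lit 1)) (layout inp R2 h b u) (layout inp ?R3 h b u) 1"
    using exec_block[of "set_reg 2 (Lit 1)" R2 h b u] small width_ge[of 1] by (simp add: bits_numerals)
  have "good I (total_steps * ?U) ([Loop (Sub (Add time_budget (Lit 1)) now) act], layout inp ?R3 h b u, init_env,
      0 + 1 + (2 * n + 3) * ?U + 1 + (6 * q + 5) * ?U + 1 + (B * (n * (8 * q + 16) + 6 * (q + B + 2) + 25) + 5) * ?U
      + 1 + 1 * ?U) (plan_potential v b init_env)"
  proof (rule good_follow[OF bal small(2-) s3])
    show "1 + B = B + 1" by simp
    \<comment> \<open>The 10 spare units of \<open>total_steps\<close> absorb four sequencing steps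
      and the assignment that initializes the clock.\<close>
    show "0 + 1 + (2 * n + 3) * ?U + 1 + (6 * q + 5) * ?U + 1
      + (B * (n * (8 * q + 16) + 6 * (q + B + 2) + 25) + 5) * ?U + 1 + 1 * ?U + (4 * B + 1) * ?U \<le> total_steps * ?U"
      using unit_cost_pos[of width] unfolding total_steps_def add_mult_distrib by linarith
  qed (simp_all add: init_env_def)
  then have "good I (total_steps * ?U) (init_config I program) (plan_potential v b init_env)"
    unfolding init_config_def program_def follow_plan_def
    by (intro good_Seq[OF exec_locate_end] good_Seq[OF 1] good_Seq[OF 2] good_Seq[OF 3])
  \<comment> \<open>No job has been started yet, so every price still counts.\<close>
  moreover have "plan_potential v b init_env = tail_price v 1"
    by (simp add: plan_potential_def init_env_def env_reward_def plan_value_def tail_price_def)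
  ultimately show ?thesis
    using that[of "tail_price v 1"] OPT_LP_le[OF bal] OPT_policy_le[OF bal] by simp
qed

end

theorem theorem6:
  "\<exists>c d :: nat. \<forall>\<epsilon> :: real. \<epsilon> > 0 \<longrightarrow>
     (\<exists>P :: com. \<forall>I. valid_inst I \<longrightarrow>
        runs_in_time I P (real c * (1 + real (input_size I) + 1 / \<epsilon>) ^ d) \<and>
        alg_reward I P \<ge> (1 / 2 - \<epsilon>) * OPT_LP I \<and>
        alg_reward I P \<ge> (1 / 2 - \<epsilon>) * OPT_policy I)"
\<comment> \<open>Constant and exponent come from \<open>time_bound\<close>; adding
  \<open>1 / \<epsilon>\<close> to the base only enlarges the bound.\<close>
proof (rule exI[of _ 100000000], rule exI[of _ 6], intro allI impI exI[of _ program])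
  fix \<epsilon> :: real and I
  assume eps: "\<epsilon> > 0" and "valid_inst I"
  then interpret knapsack I by unfold_locales
  obtain v where v: "OPT_LP I \<le> 2 * v" "OPT_policy I \<le> 2 * v"
    and good: "good I (total_steps * unit_cost width) (init_config I program) v"
    by (rule good_program)
  have "real (total_steps * unit_cost width) \<le> real (100000000 * (input_size I + 1) ^ 6)"
    by (intro of_nat_mono time_bound)
  also have "\<dots> = real 100000000 * (1 + real (input_size I)) ^ 6"
    by (simp add: add.commute)
  also have "\<dots> \<le> real 100000000 * (1 + real (input_size I) + 1 / \<epsilon>) ^ 6"
    using eps by (intro mult_left_mono power_mono) auto
  finally have "runs_in_time I program (real 100000000 * (1 + real (input_size I) + 1 / \<epsilon>) ^ 6)"
    by (rule good_correct(1)[OF valid good])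
  moreover have reward: "v \<le> alg_reward I program"
    by (rule good_correct(2)[OF valid good order_refl])
  \<comment> \<open>Passing from factor \<open>1 / 2\<close> to \<open>1 / 2 - \<epsilon>\<close>
    requires a nonnegative optimum, which both optimum values have been shown to be.\<close>
  moreover have "(1 / 2 - \<epsilon>) * w \<le> v" if "0 \<le> w" "w \<le> 2 * v" for w
  proof -
    have "0 \<le> \<epsilon> * w" using eps that(1) by simp
    then show ?thesis using that(2) by (simp add: left_diff_distrib)
  qed
  ultimately show "runs_in_time I program (real 100000000 * (1 + real (input_size I) + 1 / \<epsilon>) ^ 6) \<and>
        alg_reward I program \<ge> (1 / 2 - \<epsilon>) * OPT_LP I \<and>
        alg_reward I program \<ge> (1 / 2 - \<epsilon>) * OPT_policy I"
    using v OPT_LP_nonneg OPT_policy_nonneg order_trans[OF _ reward] by blast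
qed

end
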